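(* Let $x=(x_1,\dots,x_m)$ and $y=(y_1,\dots,y_n)$ be tuples of indeterminates, let $f_1,\dots,f_m\in\mathbb{C}[y][x]$, put $F=(f_1,\dots,f_m)$, and suppose that the ideal $\mathcal{I}=\langle f_1,\dots,f_m\rangle\subset\mathbb{C}(y)[x]$ is zero-dimensional and radical, with zero-set $\mathcal{Z}(\mathcal{I})\subset\overline{\mathbb{C}(y)}^m$ consisting of $d$ points. Let $T=(T_1,\dots,T_m)$ be the companion matrices of $\mathcal{I}$ with respect to a Gröbner basis of $\mathcal{I}$. Let $0\le p\le m$, let $I\in\binom{[m]}{p}$, and let $\omega(x)=\underline{\omega}(x)\bigwedge_{i\in I}dx_i$ be a rational $p$-form, where $\underline{\omega}\in\mathbb{C}(x)$ has a denominator that does not vanish at any point of $\mathcal{Z}(\mathcal{I})$. For $J\in\binom{[n]}{p}$ define $$\underline{\omega}_{I,J}(x)=(-1)^p\,\underline{\omega}(x)\left|\left(\frac{\partial F}{\partial x}\right)^{-1}\frac{\partial F}{\partial y}\right|_{I,J}\in\mathbb{C}(y)(x).$$ Then the pushforward of $\omega$ via $\mathcal{I}$ is $$\mathcal{I}_\ast\omega=\sum_{J\in\binom{[n]}{p}}\operatorname{Tr}\big(\underline{\omega}_{I,J}(T)\big)\bigwedge_{j\in J}dy_j .$$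
   Context: $[m]=\{1,\dots,m\}$ and $\binom{[m]}{p}$ is the set of $p$-element subsets, taken in increasing order. $|M|_{I,J}$ denotes the minor of a matrix $M$ with row set $I$ and column set $J$. $\overline{\mathbb{C}(y)}$ is the algebraic closure of $\mathbb{C}(y)$; the derivations $\partial/\partial y_j$ of $\mathbb{C}(y)$ extend uniquely to it. $\partial F/\partial x$ is the $m\times m$ matrix with entries $\partial f_\ell/\partial x_i$, and $\partial F/\partial y$ is the $m\times n$ matrix with entries $\partial f_\ell/\partial y_j$ (with $x$ and $y$ treated as independent variables). Under the hypotheses $\partial F/\partial x$ is invertible at every point of $\mathcal{Z}(\mathcal{I})$. Zero-set: $\mathcal{Z}(\mathcal{I})=\{\xi\in\overline{\mathbb{C}(y)}^m : h(\xi)=0 \text{ for all } h\in\mathcal{I}\}$. Pushforward: for $\omega=\underline{\omega}\bigwedge_{i\in I}dx_i$, $$\mathcal{I}_\ast\omega=\sum_{\xi\in\mathcal{Z}(\mathcal{I})}\xi^\ast\omega=\sum_{J\in\binom{[n]}{p}}\Big(\sum_{\xi\in\mathcal{Z}(\mathcal{I})}\underline{\omega}(\xi)\left|\frac{\partial\xi}{\partial y}\right|_{I,J}\Big)\bigwedge_{j\in J}dy_j,$$ where $\partial\xi/\partial y$ is the $m\times n$ matrix with entries $\partial\xi_i/\partial y_j\in\overline{\mathbb{C}(y)}$. Companion matrices: fix a Gröbner basis $\mathcal{G}$ of $\mathcal{I}$ with respect to a monomial ordering, and let $\{e_1,\dots,e_d\}$ be the associated standard basis of $\mathcal{Q}=\mathbb{C}(y)[x]/\mathcal{I}$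 (the monomials in $x$ not divisible by any leading term of $\mathcal{G}$). For $i\in[m]$, $T_i\in\mathrm{Mat}_{d,d}(\mathbb{C}(y))$ is defined by $\overline{x_ie_\alpha}^{\mathcal{G}}=\sum_{\beta=1}^d(T_i)_{\alpha\beta}e_\beta$, where $\overline{h}^{\mathcal{G}}$ is the normal form (remainder on division by $\mathcal{G}$). The $T_i$ commute pairwise. For a rational function $r=a/b$ with $a,b\in\mathbb{C}(y)[x]$ and $b$ non-vanishing on $\mathcal{Z}(\mathcal{I})$, $r(T)=a(T)\,b(T)^{-1}$. *)

theory Defs
  imports
    "HOL-Analysis.Cartesian_Space"
    "HOL-Library.Poly_Mapping"
    "HOL-Computational_Algebra.Fraction_Field"
    "HOL-Algebra.Algebraic_Closure_Type"
    "Jordan_Normal_Form.Determinant"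
    "Jordan_Normal_Form.Gauss_Jordan_Elimination"
begin

text \<open>
  The index sets \<open>[m]\<close> and \<open>[n]\<close> are rendered as finite linearly ordered types \<open>'m\<close>, \<open>'n\<close>,
  and \<open>('v, 'a) mpoly\<close> is the polynomial ring over \<open>'a\<close> in the variables \<open>'v\<close>.
  (The linear order on \<open>'v\<close> is also what makes \<open>('v, 'a) mpoly\<close> an instance of \<open>idom\<close>.)
  Two matrix libraries are used: \<open>'a^'n^'m\<close> for the Jacobians and \<open>'a mat\<close> for the companion
  matrices and for minors, whose sizes are not types.
\<close>

type_synonym 'v monom = "'v \<Rightarrow>\<^sub>0 nat"
type_synonym ('v, 'a) mpoly = "('v \<Rightarrow>\<^sub>0 nat) \<Rightarrow>\<^sub>0 'a"
type_synonym 'n ratfun = "('n, complex) mpoly fract"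
type_synonym 'n algfun = "'n ratfun alg_closure"


section \<open>Polynomials and rational functions\<close>

definition mconst :: "'a::zero \<Rightarrow> ('v, 'a) mpoly" where
  "mconst c = Poly_Mapping.single 0 c"

definition mvar :: "'v \<Rightarrow> ('v, 'a::zero_neq_one) mpoly" where
  "mvar v = Poly_Mapping.single (Poly_Mapping.single v 1) 1"

definition mpderiv :: "'v \<Rightarrow> ('v, 'a::comm_semiring_1) mpoly \<Rightarrow> ('v, 'a) mpoly" where
  "mpderiv v q = (\<Sum>t\<in>Poly_Mapping.keys q.
     Poly_Mapping.single (t - Poly_Mapping.single v 1)
       (of_nat (Poly_Mapping.lookup t v) * Poly_Mapping.lookup q t))"

definition frac :: "'a::idom \<Rightarrow> 'a fract" where
  "frac a = Fract a 1"

text \<open>Evaluation at the point \<open>\<xi>\<close>, the coefficients being mapped by the ring homomorphism \<open>\<phi>\<close>.\<close>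

definition mpeval :: "('a::zero \<Rightarrow> 'b::comm_semiring_1) \<Rightarrow> ('v::finite \<Rightarrow> 'b) \<Rightarrow> ('v, 'a) mpoly \<Rightarrow> 'b" where
  "mpeval \<phi> \<xi> q = (\<Sum>t\<in>Poly_Mapping.keys q.
     \<phi> (Poly_Mapping.lookup q t) * (\<Prod>v\<in>UNIV. \<xi> v ^ Poly_Mapping.lookup t v))"

text \<open>The value \<open>a(\<xi>)/b(\<xi>)\<close> of \<open>r = a/b\<close>; it does not depend on the representation with
  \<open>b(\<xi>) \<noteq> 0\<close>, and is unspecified if there is none.\<close>

definition rateval ::
  "('a::idom \<Rightarrow> 'b::field) \<Rightarrow> ('v::{finite,linorder} \<Rightarrow> 'b) \<Rightarrow> ('v, 'a) mpoly fract \<Rightarrow> 'b" where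
  "rateval \<phi> \<xi> r = (SOME c. \<exists>a b. b \<noteq> 0 \<and> r = Fract a b \<and> mpeval \<phi> \<xi> b \<noteq> 0 \<and>
     c = mpeval \<phi> \<xi> a / mpeval \<phi> \<xi> b)"


section \<open>Derivations of the rational functions in y and of their algebraic closure\<close>

definition derivation :: "('k::comm_ring_1 \<Rightarrow> 'k) \<Rightarrow> bool" where
  "derivation D \<longleftrightarrow> (\<forall>a b. D (a + b) = D a + D b) \<and> (\<forall>a b. D (a * b) = D a * b + a * D b)"

text \<open>Quotient rule; the value does not depend on the representation \<open>a/b\<close>.\<close>

definition ratfun_deriv :: "'n \<Rightarrow> 'n::{finite,linorder} ratfun \<Rightarrow> 'n ratfun" where
  "ratfun_deriv j r = (SOME s. \<exists>a b. b \<noteq> 0 \<and> r = Fract a b \<and>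
     s = Fract (mpderiv j a * b - a * mpderiv j b) (b * b))"

definition algfun_deriv :: "'n \<Rightarrow> 'n::{finite,linorder} algfun \<Rightarrow> 'n algfun" where
  "algfun_deriv j = (THE D. derivation D \<and> (\<forall>r. D (to_ac r) = to_ac (ratfun_deriv j r)))"


section \<open>Ideals and Groebner bases\<close>

definition ideal_gen :: "'a::comm_ring_1 set \<Rightarrow> 'a set" where
  "ideal_gen S = module.span (*) S"

definition radical_ideal :: "'a::comm_ring_1 set \<Rightarrow> bool" where
  "radical_ideal \<I> \<longleftrightarrow> (\<forall>h k. h ^ k \<in> \<I> \<longrightarrow> h \<in> \<I>)"

text \<open>The quotient ring is finite-dimensional as a vector space over the coefficient field.\<close>

definition zero_dimensional :: "('v, 'k::field) mpoly set \<Rightarrow> bool" where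
  "zero_dimensional \<I> \<longleftrightarrow>
     (\<exists>B. finite B \<and> (\<forall>h. \<exists>c. h - (\<Sum>b\<in>B. mconst (c b) * b) \<in> \<I>))"

definition zero_set :: "('m::finite, 'k::field) mpoly set \<Rightarrow> ('m \<Rightarrow> 'k alg_closure) set" where
  "zero_set \<I> = {\<xi>. \<forall>h\<in>\<I>. mpeval to_ac \<xi> h = 0}"

definition monomial_ordering :: "('v monom \<Rightarrow> 'v monom \<Rightarrow> bool) \<Rightarrow> bool" where
  "monomial_ordering mle \<longleftrightarrow> class.wellorder mle (\<lambda>s t. mle s t \<and> \<not> mle t s) \<and>
     (\<forall>s t u. mle s t \<longrightarrow> mle (s + u) (t + u))"

definition lead_monom :: "('v monom \<Rightarrow> 'v monom \<Rightarrow> bool) \<Rightarrow> ('v, 'k::zero) mpoly \<Rightarrow> 'v monom" where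
  "lead_monom mle q = (THE t. t \<in> Poly_Mapping.keys q \<and> (\<forall>s\<in>Poly_Mapping.keys q. mle s t))"

definition lead_term :: "('v monom \<Rightarrow> 'v monom \<Rightarrow> bool) \<Rightarrow> ('v, 'k::zero) mpoly \<Rightarrow> ('v, 'k) mpoly" where
  "lead_term mle q =
     Poly_Mapping.single (lead_monom mle q) (Poly_Mapping.lookup q (lead_monom mle q))"

definition groebner_basis ::
  "('v monom \<Rightarrow> 'v monom \<Rightarrow> bool) \<Rightarrow> ('v, 'k::field) mpoly set \<Rightarrow> ('v, 'k) mpoly set \<Rightarrow> bool" where
  "groebner_basis mle \<I> G \<longleftrightarrow> finite G \<and> G \<subseteq> \<I> \<and>
     ideal_gen (lead_term mle ` (G - {0})) = ideal_gen (lead_term mle ` (\<I> - {0}))"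

definition standard_monoms ::
  "('v monom \<Rightarrow> 'v monom \<Rightarrow> bool) \<Rightarrow> ('v, 'k::zero) mpoly set \<Rightarrow> 'v monom set" where
  "standard_monoms mle G = {t. \<not> (\<exists>g\<in>G - {0}. \<exists>u. t = lead_monom mle g + u)}"

text \<open>Remainder on division of \<open>h\<close> by \<open>G\<close>. The quotients \<open>q g\<close> are subject to the usual condition
  of the division theorem: no monomial of \<open>q g * g\<close> exceeds the leading monomial of \<open>h\<close>.\<close>

definition division_remainder ::
  "('v monom \<Rightarrow> 'v monom \<Rightarrow> bool) \<Rightarrow> ('v, 'k::field) mpoly set \<Rightarrow> ('v, 'k) mpoly \<Rightarrow>
   ('v, 'k) mpoly \<Rightarrow> bool" where
  "division_remainder mle G h r \<longleftrightarrow>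
     (\<exists>q. h = (\<Sum>g\<in>G. q g * g) + r \<and>
          (\<forall>g\<in>G. \<forall>t\<in>Poly_Mapping.keys (q g * g). \<exists>s\<in>Poly_Mapping.keys h. mle t s)) \<and>
     Poly_Mapping.keys r \<subseteq> standard_monoms mle G"

definition normal_form ::
  "('v monom \<Rightarrow> 'v monom \<Rightarrow> bool) \<Rightarrow> ('v, 'k::field) mpoly set \<Rightarrow> ('v, 'k) mpoly \<Rightarrow> ('v, 'k) mpoly" where
  "normal_form mle G h = (THE r. division_remainder mle G h r)"


section \<open>Companion matrices\<close>

text \<open>\<open>es\<close> lists the standard monomials; matrix indices start at 0.\<close>

definition companion_matrix ::
  "('v monom \<Rightarrow> 'v monom \<Rightarrow> bool) \<Rightarrow> ('v, 'k::field) mpoly set \<Rightarrow> 'v monom list \<Rightarrow> 'v \<Rightarrow> 'k mat" where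
  "companion_matrix mle G es i = mat (length es) (length es) (\<lambda>(\<alpha>, \<beta>).
     Poly_Mapping.lookup (normal_form mle G (mvar i * Poly_Mapping.single (es ! \<alpha>) 1)) (es ! \<beta>))"

text \<open>Substitution of \<open>d \<times> d\<close> matrices that commute pairwise. The sum is taken entrywise because
  \<open>mat\<close>, whose sizes are not in the type, has no zero for \<open>sum\<close>.\<close>

definition monom_at_mats ::
  "nat \<Rightarrow> ('v::{finite,linorder} \<Rightarrow> 'k::comm_ring_1 mat) \<Rightarrow> 'v monom \<Rightarrow> 'k mat" where
  "monom_at_mats d T t =
     foldr (\<lambda>v M. T v ^\<^sub>m Poly_Mapping.lookup t v * M) (sorted_list_of_set UNIV) (1\<^sub>m d)"

definition mpoly_at_mats ::
  "nat \<Rightarrow> ('v::{finite,linorder} \<Rightarrow> 'k::comm_ring_1 mat) \<Rightarrow> ('v, 'k) mpoly \<Rightarrow> 'k mat" where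
  "mpoly_at_mats d T q = mat d d (\<lambda>ij. \<Sum>t\<in>Poly_Mapping.keys q.
     Poly_Mapping.lookup q t * monom_at_mats d T t $$ ij)"

text \<open>\<open>r(T) = a(T) b(T)\<^sup>-\<^sup>1\<close> for any representation \<open>r = a/b\<close> with \<open>b\<close> non-vanishing on \<open>Z\<close>.\<close>

definition rat_at_mats ::
  "('m::{finite,linorder} \<Rightarrow> 'k::field alg_closure) set \<Rightarrow> nat \<Rightarrow> ('m \<Rightarrow> 'k mat) \<Rightarrow>
   ('m, 'k) mpoly fract \<Rightarrow> 'k mat" where
  "rat_at_mats Z d T r = (SOME M. \<exists>a b. b \<noteq> 0 \<and> r = Fract a b \<and>
     (\<forall>\<xi>\<in>Z. mpeval to_ac \<xi> b \<noteq> 0) \<and>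
     M = mpoly_at_mats d T a * the (mat_inverse (mpoly_at_mats d T b)))"

definition mat_trace :: "'k::comm_monoid_add mat \<Rightarrow> 'k" where
  "mat_trace A = (\<Sum>i<dim_row A. A $$ (i, i))"


section \<open>Minors and Jacobians\<close>

text \<open>For \<open>card I = card J\<close>; rows and columns are taken in increasing order.\<close>

definition minor ::
  "'a::comm_ring_1^'n::{finite,linorder}^'m::{finite,linorder} \<Rightarrow> 'm set \<Rightarrow> 'n set \<Rightarrow> 'a" where
  "minor M I J = Determinant.det (mat (card I) (card J) (\<lambda>(a, b).
     vec_nth (vec_nth M (sorted_list_of_set I ! a)) (sorted_list_of_set J ! b)))"

type_synonym ('m, 'n) ypoly = "('m, ('n, complex) mpoly) mpoly"
type_synonym ('m, 'n) xratfun = "('m, 'n ratfun) mpoly fract"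

text \<open>The inclusions of \<open>\<complex>[y][x]\<close> into \<open>\<complex>(y)[x]\<close>, and of \<open>\<complex>\<close> into \<open>\<complex>(y)\<close>.\<close>

definition ypoly_incl :: "('m, 'n::{finite,linorder}) ypoly \<Rightarrow> ('m, 'n ratfun) mpoly" where
  "ypoly_incl = Poly_Mapping.map frac"

definition ratfun_const :: "complex \<Rightarrow> 'n::{finite,linorder} ratfun" where
  "ratfun_const c = frac (mconst c)"

definition system_ideal ::
  "('m::finite \<Rightarrow> ('m, 'n::{finite,linorder}) ypoly) \<Rightarrow> ('m, 'n ratfun) mpoly set" where
  "system_ideal f = ideal_gen (range (\<lambda>l. ypoly_incl (f l)))"

definition jacobian_x ::
  "('m::{finite,linorder} \<Rightarrow> ('m, 'n::{finite,linorder}) ypoly) \<Rightarrow>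
   ('m, 'n) xratfun^'m::{finite,linorder}^'m::{finite,linorder}" where
  "jacobian_x f = (\<chi> l i. frac (ypoly_incl (mpderiv i (f l))))"

definition jacobian_y ::
  "('m::{finite,linorder} \<Rightarrow> ('m, 'n::{finite,linorder}) ypoly) \<Rightarrow>
   ('m, 'n) xratfun^'n::{finite,linorder}^'m::{finite,linorder}" where
  "jacobian_y f = (\<chi> l j. frac (ypoly_incl (Poly_Mapping.map (mpderiv j) (f l))))"

definition jacobian_point ::
  "('m::{finite,linorder} \<Rightarrow> 'n::{finite,linorder} algfun) \<Rightarrow>
   'n algfun^'n::{finite,linorder}^'m::{finite,linorder}" where
  "jacobian_point \<xi> = (\<chi> i j. algfun_deriv j (\<xi> i))"


section \<open>Differential forms and pushforward\<close>

text \<open>A differential form in \<open>y\<close> is given by its coefficients: \<open>Poly_Mapping.single J c\<close> is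
  \<open>c \<And>\<^sub>j\<^sub>\<in>\<^sub>J dy\<^sub>j\<close>, the factors being taken in increasing order. The monomial form
  \<open>w \<And>\<^sub>i\<^sub>\<in>\<^sub>I dx\<^sub>i\<close> in \<open>x\<close> is given by the pair \<open>w\<close>, \<open>I\<close>.\<close>

type_synonym 'n yform = "'n set \<Rightarrow>\<^sub>0 'n algfun"

definition pullback ::
  "('m::{finite,linorder} \<Rightarrow> 'n::{finite,linorder} algfun) \<Rightarrow> ('m, complex) mpoly fract \<Rightarrow> 'm set \<Rightarrow>
   'n yform" where
  "pullback \<xi> w I = (\<Sum>J\<in>{J. card J = card I}. Poly_Mapping.single J
     (rateval (\<lambda>c. to_ac (ratfun_const c)) \<xi> w * minor (jacobian_point \<xi>) I J))"

definition pushforward ::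
  "('m::{finite,linorder}, 'n::{finite,linorder} ratfun) mpoly set \<Rightarrow> ('m, complex) mpoly fract \<Rightarrow>
   'm set \<Rightarrow> 'n yform" where
  "pushforward \<I> w I = (\<Sum>\<xi>\<in>zero_set \<I>. pullback \<xi> w I)"

text \<open>\<open>\<complex>(x)\<close> is embedded into \<open>\<complex>(y)(x)\<close> by evaluating at the point \<open>(x\<^sub>i)\<^sub>i\<close>.\<close>

definition xratfun_incl ::
  "('m::{finite,linorder}, complex) mpoly fract \<Rightarrow> ('m, 'n::{finite,linorder}) xratfun" where
  "xratfun_incl = rateval (\<lambda>c. frac (mconst (ratfun_const c))) (\<lambda>i. frac (mvar i))"

definition omega_minor ::
  "('m::{finite,linorder} \<Rightarrow> ('m, 'n::{finite,linorder}) ypoly) \<Rightarrow> ('m, complex) mpoly fract \<Rightarrow>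
   'm set \<Rightarrow> 'n set \<Rightarrow> ('m, 'n) xratfun" where
  "omega_minor f w I J = (- 1) ^ card I * xratfun_incl w *
     minor (matrix_inv (jacobian_x f) ** jacobian_y f) I J"

end

theory Submission
  imports Defs "HOL-Analysis.Determinants"
begin

text \<open>
  Write \<open>K = \<complex>(y)\<close> and \<open>L\<close> for its algebraic closure. A \<open>K\<close>-linear functional \<open>K[x] \<rightarrow> L\<close> that kills \<open>\<I>\<close> is an
  \<open>L\<close>-combination of evaluations at the points of \<open>Z(\<I>)\<close>: the transposed multiplications by the \<open>x\<^sub>i\<close>
  commute, each is annihilated by a polynomial with simple roots because \<open>\<I>\<close> is radical, and a joint
  eigenfunctional is a multiple of an evaluation. Applied to the coordinates of the normal form, this
  shows that the vectors \<open>(e\<^sub>\<alpha>(\<xi>))\<^sub>\<alpha>\<close> diagonalise the companion matrices simultaneously over \<open>L\<close>, so that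
  \<open>Tr r(T) = \<Sum>\<^sub>\<xi> r(\<xi>)\<close>.

  A kernel vector of \<open>\<partial>F/\<partial>x\<close> at \<open>\<xi>\<close> is a point derivation killing \<open>\<I>\<close>, in particular the polynomials in
  one \<open>x\<^sub>i\<close> with simple roots, so it is zero. Hence differentiating \<open>F(\<xi>) = 0\<close> gives
  \<open>\<partial>\<xi>/\<partial>y = - (\<partial>F/\<partial>x)\<^sup>-\<^sup>1 \<partial>F/\<partial>y\<close> at \<open>\<xi>\<close>, and the theorem is the trace formula for \<open>r = \<omega>\<^sub>I\<^sub>J\<close>.
\<close>

section \<open>Multivariate polynomials\<close>

text \<open>The functionals take values in \<open>L\<close> while their arguments stay in
  \<open>K[x]\<close>. Eigenvalues are thus available without extending the ideal to
  \<open>L[x]\<close>, where radicality and the Groebner basis would have to be transported. Points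
  of the zero set appear as the eigenvalue tuples of joint eigenfunctionals. Characteristic 0 enters
  through separability: a multiple root in \<open>L\<close> of a polynomial over \<open>K\<close>
  produces the square of a minimal polynomial as a factor over \<open>K\<close>. The diagonalisation
  is expressed by dual relations between the values \<open>e_\<alpha>(\<xi>)\<close> and
  interpolation weights, since no bijection between points and standard monomials is at hand. The
  entries of \<open>\<partial>\<xi>/\<partial>y\<close> are given by a definite description, so they
  have a meaning only once existence and uniqueness of the extended derivation are established.
  Several values are taken from an arbitrary representation \<open>a/b\<close>; each must be shown
  independent of that choice, and Cramer's rule supplies the representation of the integrand whose
  denominator does not vanish on the zero set.\<close>

lemma lookup_map [simp]:
  "f 0 = 0 \<Longrightarrow> Poly_Mapping.lookup (Poly_Mapping.map f p) t = f (Poly_Mapping.lookup p t)"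
  by (simp add: Poly_Mapping.map.rep_eq when_def)

lemma sum_single_lookup:
  "(\<Sum>t\<in>Poly_Mapping.keys p. Poly_Mapping.single t (Poly_Mapping.lookup p t)) = p"
  by (rule poly_mapping_eqI)
    (auto simp: lookup_sum lookup_single when_def sum.delta in_keys_iff cong: if_cong)

text \<open>Keys are arbitrary, so the rule serves polynomials (keys are monomials) and, in
  \<open>monom_induct\<close>, the monomials themselves (keys are variables). Zero has no case of
  its own because it is a \<open>single\<close> with coefficient 0.\<close>

lemma mpoly_single_induct [case_names single add]:
  fixes p :: "'t \<Rightarrow>\<^sub>0 'a::comm_monoid_add"
  assumes single: "\<And>t c. P (Poly_Mapping.single t c)" and add: "\<And>p q. P p \<Longrightarrow> P q \<Longrightarrow> P (p + q)"
  shows "P p"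
proof -
  have "P 0" using single[of undefined 0] by simp
  have "P (\<Sum>t\<in>A. Poly_Mapping.single t (Poly_Mapping.lookup p t))" if "finite A" for A
    using that by (induction A) (auto intro: single add \<open>P 0\<close>)
  from this[of "Poly_Mapping.keys p"] show ?thesis by (simp add: sum_single_lookup)
qed

lemma monom_induct [case_names one var mult]:
  fixes t :: "'v monom"
  assumes one: "P 0" and var: "\<And>v. P (Poly_Mapping.single v 1)"
    and mult: "\<And>s t. P s \<Longrightarrow> P t \<Longrightarrow> P (s + t)"
  shows "P t"
proof (induction t rule: mpoly_single_induct)
  case (single v n)
  show ?case
  proof (induction n)
    case (Suc n)
    have "Poly_Mapping.single v (Suc n) = Poly_Mapping.single v 1 + Poly_Mapping.single v n"
      by (simp flip: single_add)
    with Suc show ?case by (metis var mult)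
  qed (simp add: one)
qed (rule mult)

lemma single_conv_mconst: "Poly_Mapping.single t c = (mconst c * Poly_Mapping.single t 1 :: ('v, 'a::comm_semiring_1) mpoly)"
  by (simp add: mconst_def mult_single)

lemma mconst_simps:
  "mconst 0 = 0" "mconst 1 = 1" "mconst (a + b) = mconst a + mconst b"
  "mconst (a * b) = mconst a * mconst b"
  by (simp_all add: mconst_def single_add mult_single)

lemma mconst_eq_0_iff: "mconst c = 0 \<longleftrightarrow> c = 0"
  unfolding mconst_def by (metis lookup_single_eq lookup_zero single_zero)

lemma mpoly_induct [case_names const var add mult]:
  fixes p :: "('v, 'a::comm_semiring_1) mpoly"
  assumes const: "\<And>c. P (mconst c)" and var: "\<And>v. P (mvar v)"
    and add: "\<And>p q. P p \<Longrightarrow> P q \<Longrightarrow> P (p + q)" and mult: "\<And>p q. P p \<Longrightarrow> P q \<Longrightarrow> P (p * q)"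
  shows "P p"
proof (induction p rule: mpoly_single_induct)
  case (single t c)
  have "P (Poly_Mapping.single t 1)"
  proof (induction t rule: monom_induct)
    case one
    from const[of 1] show ?case by (simp add: mconst_simps)
  next
    case (var v)
    from assms(2)[of v] show ?case by (simp add: mvar_def)
  next
    case (mult s t)
    from assms(4)[OF this] show ?case by (simp add: mult_single)
  qed
  with const[of c] show ?case by (subst single_conv_mconst) (rule mult)
qed (rule add)

section \<open>Evaluation at a point\<close>

text \<open>Cancellation makes the \<open>keys\<close> of a sum unpredictable; a common finite index
  set makes evaluation visibly additive.\<close>

lemma mpeval_superset:
  assumes "\<phi> 0 = 0" "finite S" "Poly_Mapping.keys q \<subseteq> S"
  shows "mpeval \<phi> \<xi> q = (\<Sum>t\<in>S. \<phi> (Poly_Mapping.lookup q t) * (\<Prod>v\<in>UNIV. \<xi> v ^ Poly_Mapping.lookup t v))"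
  unfolding mpeval_def using assms
  by (intro sum.mono_neutral_left) (auto simp: in_keys_iff)

lemma mpeval_single:
  "\<phi> 0 = 0 \<Longrightarrow> mpeval \<phi> \<xi> (Poly_Mapping.single t c) = \<phi> c * (\<Prod>v\<in>UNIV. \<xi> v ^ Poly_Mapping.lookup t v)"
  by (subst mpeval_superset[where S = "{t}"]) auto

lemma mpeval_mconst: "\<phi> 0 = 0 \<Longrightarrow> mpeval \<phi> \<xi> (mconst c) = \<phi> c"
  by (simp add: mconst_def mpeval_single)

lemma prod_power_single:
  "(\<Prod>v\<in>UNIV. \<xi> v ^ Poly_Mapping.lookup (Poly_Mapping.single i n) v) = (\<xi> (i::'v::finite) ^ n :: 'b::comm_semiring_1)"
proof -
  have "(\<Prod>v\<in>UNIV. \<xi> v ^ Poly_Mapping.lookup (Poly_Mapping.single i n) v) = (\<Prod>v\<in>UNIV. if v = i then \<xi> i ^ n else 1)"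
    by (intro prod.cong) (auto simp: lookup_single when_def)
  then show ?thesis by simp
qed

lemma (in comm_ring_hom) mpeval_mvar: "mpeval hom \<xi> (mvar i) = \<xi> i"
  using prod_power_single[of \<xi> i 1] by (simp add: mvar_def mpeval_single)

lemma (in comm_ring_hom) mpeval_add: "mpeval hom \<xi> (p + q) = mpeval hom \<xi> p + mpeval hom \<xi> q"
proof -
  let ?S = "Poly_Mapping.keys p \<union> Poly_Mapping.keys q"
  have "Poly_Mapping.keys (p + q) \<subseteq> ?S" by (rule Poly_Mapping.keys_add)
  then have 1: "mpeval hom \<xi> r = (\<Sum>t\<in>?S. hom (Poly_Mapping.lookup r t) * (\<Prod>v\<in>UNIV. \<xi> v ^ Poly_Mapping.lookup t v))"
    if "r \<in> {p, q, p + q}" for r using that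
    by (intro mpeval_superset) auto
  have "mpeval hom \<xi> (p + q) = (\<Sum>t\<in>?S. hom (Poly_Mapping.lookup p t) * (\<Prod>v\<in>UNIV. \<xi> v ^ Poly_Mapping.lookup t v)
     + hom (Poly_Mapping.lookup q t) * (\<Prod>v\<in>UNIV. \<xi> v ^ Poly_Mapping.lookup t v))"
    by (subst 1) (auto simp: lookup_add hom_add algebra_simps)
  also have "\<dots> = mpeval hom \<xi> p + mpeval hom \<xi> q"
    by (subst (1 2) 1) (auto simp: sum.distrib)
  finally show ?thesis .
qed

lemma (in comm_ring_hom) mpeval_mult: "mpeval hom \<xi> (p * q) = mpeval hom \<xi> p * mpeval hom \<xi> q"
proof (induction p rule: mpoly_single_induct)
  case (single s c)
  show ?case
  proof (induction q rule: mpoly_single_induct)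
    case (single t d)
    show ?case
      by (simp add: mult_single mpeval_single hom_mult lookup_add power_add prod.distrib algebra_simps)
  qed (simp add: distrib_left mpeval_add)
qed (simp add: distrib_right mpeval_add)

lemma (in comm_ring_hom) mpeval_hom: "comm_ring_hom (mpeval hom \<xi>)"
proof
  show "mpeval hom \<xi> 0 = 0" by (simp add: mpeval_def)
  show "mpeval hom \<xi> 1 = 1" using mpeval_mconst[of hom \<xi> 1] by (simp add: mconst_simps)
qed (simp_all add: mpeval_add mpeval_mult)

lemma comm_ring_homI:
  assumes "\<phi> 1 = 1" "\<And>a b. \<phi> (a + b) = \<phi> a + \<phi> b" "\<And>a b. \<phi> (a * b) = \<phi> a * \<phi> b"
  shows "comm_ring_hom (\<phi> :: 'a::comm_ring_1 \<Rightarrow> 'b::comm_ring_1)"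
proof
  have "\<phi> 0 + \<phi> 0 = \<phi> 0" using assms(2)[of 0 0] by simp
  then show "\<phi> 0 = 0" by simp
qed (fact assms)+

lemma mpoly_hom_eqI:
  assumes "comm_ring_hom (\<phi> :: ('v, 'a::comm_ring_1) mpoly \<Rightarrow> 'b::comm_ring_1)" "comm_ring_hom \<psi>"
    and "\<And>c. \<phi> (mconst c) = \<psi> (mconst c)" "\<And>v. \<phi> (mvar v) = \<psi> (mvar v)"
  shows "\<phi> p = \<psi> p"
proof -
  interpret \<phi>: comm_ring_hom \<phi> by fact
  interpret \<psi>: comm_ring_hom \<psi> by fact
  show ?thesis
    by (induction p rule: mpoly_induct) (simp_all add: assms \<phi>.hom_add \<psi>.hom_add \<phi>.hom_mult \<psi>.hom_mult)
qed

section \<open>Coefficientwise maps, fractions and embeddings\<close>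

lemma map_add_mpoly:
  assumes "f 0 = 0" "\<And>a b. f (a + b) = f a + f b"
  shows "Poly_Mapping.map f (p + q) = Poly_Mapping.map f p + Poly_Mapping.map f q"
  by (rule poly_mapping_eqI) (simp add: assms lookup_add)

lemma map_mconst: "f 0 = 0 \<Longrightarrow> Poly_Mapping.map f (mconst c) = mconst (f c)"
  by (simp add: mconst_def)

lemma (in comm_ring_hom) map_mvar: "Poly_Mapping.map hom (mvar i) = mvar i"
  by (simp add: mvar_def)

lemma (in comm_ring_hom) map_mult_mpoly:
  "Poly_Mapping.map hom (p * q) = Poly_Mapping.map hom p * Poly_Mapping.map hom q"
proof (induction p rule: mpoly_single_induct)
  case (single s c)
  show ?case
  proof (induction q rule: mpoly_single_induct)
    case (single t d)
    show ?case by (simp add: mult_single hom_mult)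
  qed (simp add: distrib_left map_add_mpoly hom_add)
qed (simp add: distrib_right map_add_mpoly hom_add)

lemma (in comm_ring_hom) map_mpoly_hom:
  "comm_ring_hom (Poly_Mapping.map hom :: ('v, 'a) mpoly \<Rightarrow> ('v, 'b) mpoly)"
proof (rule comm_ring_homI)
  show "Poly_Mapping.map hom (1 :: ('v, 'a) mpoly) = (1 :: ('v, 'b) mpoly)"
    using map_mconst[of hom 1] by (simp add: mconst_simps)
qed (simp_all add: map_add_mpoly hom_add map_mult_mpoly)

lemma mpeval_map:
  assumes "\<phi> 0 = 0" "\<psi> 0 = 0"
  shows "mpeval \<phi> \<xi> (Poly_Mapping.map \<psi> p) = mpeval (\<lambda>c. \<phi> (\<psi> c)) \<xi> p"
proof -
  have "Poly_Mapping.keys (Poly_Mapping.map \<psi> p) \<subseteq> Poly_Mapping.keys p"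
    using assms by (auto simp: in_keys_iff)
  then show ?thesis
    by (subst (1 2) mpeval_superset[where S = "Poly_Mapping.keys p"]) (auto simp: assms)
qed

lemma frac_hom: "comm_ring_hom (frac :: 'a::idom \<Rightarrow> 'a fract)"
  by (rule comm_ring_homI) (simp_all add: frac_def One_fract_def)

lemma frac_eq_iff [simp]: "frac a = frac b \<longleftrightarrow> a = b"
  by (simp add: frac_def eq_fract)

lemma frac_eq_0_iff [simp]: "frac a = 0 \<longleftrightarrow> a = 0"
  by (simp add: frac_def Zero_fract_def eq_fract)

lemma Fract_conv_frac: "b \<noteq> 0 \<Longrightarrow> Fract a b = frac a / frac b"
  by (simp add: frac_def)

lemma mconst_hom: "comm_ring_hom (mconst :: 'a::comm_ring_1 \<Rightarrow> ('v, 'a) mpoly)"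
  by (rule comm_ring_homI) (simp_all add: mconst_simps)

lemma to_ac_hom: "comm_ring_hom to_ac"
  by (rule comm_ring_homI) simp_all

lemma comm_ring_hom_compose:
  assumes "comm_ring_hom f" "comm_ring_hom g"
  shows "comm_ring_hom (\<lambda>x. f (g x))"
proof -
  interpret f: comm_ring_hom f by fact
  interpret g: comm_ring_hom g by fact
  show ?thesis by (rule comm_ring_homI) (simp_all add: f.hom_add g.hom_add f.hom_mult g.hom_mult)
qed

subsection \<open>Partial derivatives\<close>

lemma mpderiv_superset:
  assumes "finite S" "Poly_Mapping.keys q \<subseteq> S"
  shows "mpderiv v q = (\<Sum>t\<in>S. Poly_Mapping.single (t - Poly_Mapping.single v 1)
       (of_nat (Poly_Mapping.lookup t v) * Poly_Mapping.lookup q t))"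
  unfolding mpderiv_def using assms
  by (intro sum.mono_neutral_left) (auto simp: in_keys_iff)

lemma mpderiv_single:
  "mpderiv v (Poly_Mapping.single t c) =
    Poly_Mapping.single (t - Poly_Mapping.single v 1) (of_nat (Poly_Mapping.lookup t v) * c)"
  by (subst mpderiv_superset[where S = "{t}"]) auto

lemma mpderiv_add: "mpderiv v (p + q) = mpderiv v p + mpderiv v q"
proof -
  let ?S = "Poly_Mapping.keys p \<union> Poly_Mapping.keys q"
  have "Poly_Mapping.keys (p + q) \<subseteq> ?S" by (rule Poly_Mapping.keys_add)
  then have 1: "mpderiv v r = (\<Sum>t\<in>?S. Poly_Mapping.single (t - Poly_Mapping.single v 1)
       (of_nat (Poly_Mapping.lookup t v) * Poly_Mapping.lookup r t))"
    if "r \<in> {p, q, p + q}" for r using that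
    by (intro mpderiv_superset) auto
  have "mpderiv v (p + q) = (\<Sum>t\<in>?S. Poly_Mapping.single (t - Poly_Mapping.single v 1)
       (of_nat (Poly_Mapping.lookup t v) * Poly_Mapping.lookup p t) + Poly_Mapping.single (t - Poly_Mapping.single v 1)
       (of_nat (Poly_Mapping.lookup t v) * Poly_Mapping.lookup q t))"
    by (subst 1) (auto simp: lookup_add algebra_simps simp flip: single_add)
  also have "\<dots> = mpderiv v p + mpderiv v q"
    by (subst (1 2) 1) (auto simp: sum.distrib)
  finally show ?thesis .
qed

lemma monom_diff_add:
  assumes "Poly_Mapping.lookup (s :: 'v monom) v > 0"
  shows "s - Poly_Mapping.single v 1 + t = s + t - Poly_Mapping.single v 1"
  by (rule poly_mapping_eqI) (use assms in \<open>auto simp: lookup_add lookup_minus lookup_single when_def\<close>)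

lemma mpderiv_mult_single:
  "mpderiv v (Poly_Mapping.single s c * Poly_Mapping.single t d) =
    mpderiv v (Poly_Mapping.single s c) * Poly_Mapping.single t d +
    Poly_Mapping.single s c * mpderiv v (Poly_Mapping.single t d)"
proof -
  let ?e = "Poly_Mapping.single v (1::nat)"
  \<comment> \<open>If \<open>v\<close> does not occur in \<open>s\<close>, the truncated
    subtraction in the exponent gives a wrong monomial, but the factor \<open>of_nat 0\<close>
    removes the term.\<close>
  have 1: "mpderiv v (Poly_Mapping.single s c) * Poly_Mapping.single t d =
    Poly_Mapping.single (s + t - ?e) (of_nat (Poly_Mapping.lookup s v) * c * d)"
    using monom_diff_add[of s v t]
    by (cases "Poly_Mapping.lookup s v = 0") (simp_all add: mpderiv_single mult_single)
  have 2: "Poly_Mapping.single s c * mpderiv v (Poly_Mapping.single t d) =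
    Poly_Mapping.single (s + t - ?e) (c * (of_nat (Poly_Mapping.lookup t v) * d))"
    using monom_diff_add[of t v s]
    by (cases "Poly_Mapping.lookup t v = 0") (simp_all add: mpderiv_single mult_single add.commute)
  show ?thesis unfolding 1 2
    by (simp add: mult_single mpderiv_single lookup_add algebra_simps flip: single_add)
qed

lemma mpderiv_mult: "mpderiv v (p * q) = mpderiv v p * q + p * mpderiv v q"
proof (induction p rule: mpoly_single_induct)
  case (single s c)
  show ?case
  proof (induction q rule: mpoly_single_induct)
    case (single t d)
    show ?case by (rule mpderiv_mult_single)
  qed (simp add: distrib_left mpderiv_add algebra_simps)
qed (simp add: distrib_right mpderiv_add algebra_simps)

lemma mpderiv_mconst [simp]: "mpderiv v (mconst c) = 0"
  by (simp add: mconst_def mpderiv_single)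

lemma mpderiv_1 [simp]: "mpderiv v 1 = 0"
  by (simp add: mpderiv_single flip: single_one)

lemma mpderiv_0 [simp]: "mpderiv v 0 = 0"
  by (simp add: mpderiv_def)

lemma mpderiv_mvar: "mpderiv v (mvar i) = (if v = i then 1 else 0)"
  by (auto simp: mvar_def mpderiv_single lookup_single)

text \<open>Serves to differentiate the coefficients in \<open>y\<close> with \<open>x\<close> held
  constant, as in the Jacobian with respect to \<open>y\<close>.\<close>

lemma map_derivation_mult:
  fixes D :: "'a::comm_ring_1 \<Rightarrow> 'a" and p q :: "('v, 'a) mpoly"
  assumes [simp]: "D 0 = 0" and add: "\<And>a b. D (a + b) = D a + D b" and mult: "\<And>a b. D (a * b) = D a * b + a * D b"
  shows "Poly_Mapping.map D (p * q) = Poly_Mapping.map D p * q + p * Poly_Mapping.map D q"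
proof (induction p rule: mpoly_single_induct)
  case (single s c)
  show ?case
  proof (induction q rule: mpoly_single_induct)
    case (single t d)
    show ?case by (simp add: mult_single mult single_add)
  qed (simp add: distrib_left map_add_mpoly add algebra_simps)
qed (simp add: distrib_right map_add_mpoly add algebra_simps)

lemma derivation_simps:
  assumes "derivation D"
  shows "D (a + b) = D a + D b" "D (a * b) = D a * b + a * D b" "D 0 = 0" "D 1 = 0"
proof -
  show add: "D (a + b) = D a + D b" and mult: "D (a * b) = D a * b + a * D b" for a b
    using assms by (auto simp: derivation_def)
  from add[of 0 0] show "D 0 = 0" by simp
  from mult[of 1 1] show "D 1 = 0" by simp
qed

text \<open>Two representations give the same quotient because the cross-multiplied equation
  \<open>a b' = a' b\<close> can itself be differentiated.\<close>

lemma ratfun_deriv_Fract: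
  assumes b: "b \<noteq> 0"
  shows "ratfun_deriv j (Fract a b) = Fract (mpderiv j a * b - a * mpderiv j b) (b * b)"
  unfolding ratfun_deriv_def
proof (rule someI2_ex)
  show "\<exists>s a' b'. b' \<noteq> 0 \<and> Fract a b = Fract a' b' \<and> s = Fract (mpderiv j a' * b' - a' * mpderiv j b') (b' * b')"
    using b by blast
next
  fix s assume "\<exists>a' b'. b' \<noteq> 0 \<and> Fract a b = Fract a' b' \<and> s = Fract (mpderiv j a' * b' - a' * mpderiv j b') (b' * b')"
  then obtain a' b' where b': "b' \<noteq> 0" and eq: "Fract a b = Fract a' b'"
    and s: "s = Fract (mpderiv j a' * b' - a' * mpderiv j b') (b' * b')" by blast
  from eq b b' have ab: "a * b' = a' * b" by (simp add: eq_fract)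
  then have d: "mpderiv j a * b' + a * mpderiv j b' = mpderiv j a' * b + a' * mpderiv j b"
    by (metis mpderiv_mult)
  have "(mpderiv j a * b - a * mpderiv j b) * (b' * b')
     = b * b' * (mpderiv j a * b' + a * mpderiv j b') - b * b' * a * mpderiv j b' - mpderiv j b * b' * (a * b')"
    by (simp add: algebra_simps)
  also have "\<dots> = b * b' * (mpderiv j a' * b + a' * mpderiv j b) - b * (a' * b) * mpderiv j b' - mpderiv j b * b' * (a' * b)"
    unfolding d ab[symmetric] by (simp add: algebra_simps)
  also have "\<dots> = (mpderiv j a' * b' - a' * mpderiv j b') * (b * b)"
    by (simp add: algebra_simps)
  finally show "s = Fract (mpderiv j a * b - a * mpderiv j b) (b * b)"
    using b b' by (simp add: s eq_fract)
qed

lemma ratfun_deriv_frac: "ratfun_deriv j (frac q) = frac (mpderiv j q)"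
  by (simp add: frac_def ratfun_deriv_Fract)

lemma derivation_ratfun_deriv: "derivation (ratfun_deriv j)"
  unfolding derivation_def
proof (intro conjI allI)
  fix r s :: "'a ratfun"
  obtain a b where r: "r = Fract a b" "b \<noteq> 0" by (cases r)
  obtain c d where s: "s = Fract c d" "d \<noteq> 0" by (cases s)
  show "ratfun_deriv j (r + s) = ratfun_deriv j r + ratfun_deriv j s"
    "ratfun_deriv j (r * s) = ratfun_deriv j r * s + r * ratfun_deriv j s"
    using r s by (simp_all add: ratfun_deriv_Fract mpderiv_mult mpderiv_add eq_fract algebra_simps)
qed

section \<open>Extending derivations to the algebraic closure\<close>

text \<open>Intermediate fields are sets inside one type, because the tower built below depends on
  elements. Zero is obtained as \<open>1 - 1\<close>, and \<open>inverse 0 = 0\<close> is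
  harmless.\<close>

definition subfield_of_type :: "'a::field set \<Rightarrow> bool" where
  "subfield_of_type F \<longleftrightarrow> 1 \<in> F \<and> (\<forall>a\<in>F. \<forall>b\<in>F. a - b \<in> F \<and> a * b \<in> F) \<and> (\<forall>a\<in>F. inverse a \<in> F)"

definition coeffs_in :: "'a::zero set \<Rightarrow> 'a poly \<Rightarrow> bool" where
  "coeffs_in F p \<longleftrightarrow> (\<forall>i. coeff p i \<in> F)"

definition derivation_on :: "'a::field set \<Rightarrow> ('a \<Rightarrow> 'a) \<Rightarrow> bool" where
  "derivation_on F d \<longleftrightarrow> (\<forall>a\<in>F. \<forall>b\<in>F. d (a + b) = d a + d b \<and> d (a * b) = d a * b + a * d b)"

text \<open>Least degree is used instead of irreducibility because divisibility and separability
  below both argue by degree.\<close>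

definition minimal_poly :: "'a::field set \<Rightarrow> 'a \<Rightarrow> 'a poly \<Rightarrow> bool" where
  "minimal_poly F a q \<longleftrightarrow> coeffs_in F q \<and> lead_coeff q = 1 \<and> poly q a = 0 \<and>
     (\<forall>g. coeffs_in F g \<and> g \<noteq> 0 \<and> poly g a = 0 \<longrightarrow> Polynomial.degree q \<le> Polynomial.degree g)"

text \<open>Separate from the field case because the result of adjoining an element is known to be a
  ring before it is shown to contain inverses.\<close>

lemma subring_closed:
  fixes F :: "'a::field set"
  assumes "1 \<in> F" "\<And>a b. a \<in> F \<Longrightarrow> b \<in> F \<Longrightarrow> a - b \<in> F" "\<And>a b. a \<in> F \<Longrightarrow> b \<in> F \<Longrightarrow> a * b \<in> F"
  shows "0 \<in> F" "a \<in> F \<Longrightarrow> - a \<in> F" "a \<in> F \<Longrightarrow> b \<in> F \<Longrightarrow> a + b \<in> F"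
    "(\<And>i. i \<in> A \<Longrightarrow> f i \<in> F) \<Longrightarrow> sum f A \<in> F" "of_nat n \<in> F"
proof -
  show 0: "0 \<in> F" using assms(2)[of 1 1] assms(1) by simp
  show m: "- a \<in> F" if "a \<in> F" for a using assms(2)[OF 0 that] by simp
  show p: "a + b \<in> F" if "a \<in> F" "b \<in> F" for a b using assms(2)[OF that(1) m[OF that(2)]] by simp
  show "(\<And>i. i \<in> A \<Longrightarrow> f i \<in> F) \<Longrightarrow> sum f A \<in> F"
    by (induction A rule: infinite_finite_induct) (auto simp: 0 p)
  show "of_nat n \<in> F" by (induction n) (auto simp: 0 p assms(1))
qed

lemma subfield_closed:
  assumes "subfield_of_type F"
  shows "0 \<in> F" "1 \<in> F" "a \<in> F \<Longrightarrow> - a \<in> F" "a \<in> F \<Longrightarrow> b \<in> F \<Longrightarrow> a + b \<in> F"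
    "a \<in> F \<Longrightarrow> b \<in> F \<Longrightarrow> a - b \<in> F" "a \<in> F \<Longrightarrow> b \<in> F \<Longrightarrow> a * b \<in> F"
    "a \<in> F \<Longrightarrow> inverse a \<in> F" "(\<And>i. i \<in> A \<Longrightarrow> f i \<in> F) \<Longrightarrow> sum f A \<in> F" "of_nat n \<in> F"
proof -
  have F: "1 \<in> F" "\<And>a b. a \<in> F \<Longrightarrow> b \<in> F \<Longrightarrow> a - b \<in> F" "\<And>a b. a \<in> F \<Longrightarrow> b \<in> F \<Longrightarrow> a * b \<in> F"
    "\<And>a. a \<in> F \<Longrightarrow> inverse a \<in> F"
    using assms by (auto simp: subfield_of_type_def)
  have R: "0 \<in> F" "\<And>a. a \<in> F \<Longrightarrow> - a \<in> F" "\<And>a b. a \<in> F \<Longrightarrow> b \<in> F \<Longrightarrow> a + b \<in> F" "of_nat n \<in> F"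
    by (rule subring_closed; simp add: F)+
  show "0 \<in> F" "1 \<in> F" "a \<in> F \<Longrightarrow> - a \<in> F" "a \<in> F \<Longrightarrow> b \<in> F \<Longrightarrow> a + b \<in> F"
    "a \<in> F \<Longrightarrow> b \<in> F \<Longrightarrow> a - b \<in> F" "a \<in> F \<Longrightarrow> b \<in> F \<Longrightarrow> a * b \<in> F"
    "a \<in> F \<Longrightarrow> inverse a \<in> F" "of_nat n \<in> F"
    using F R by auto
  show "sum f A \<in> F" if "\<And>i. i \<in> A \<Longrightarrow> f i \<in> F" by (rule subring_closed) (simp_all add: F that)
qed

lemma coeffs_in_pCons [simp]: "coeffs_in F (pCons a p) \<longleftrightarrow> a \<in> F \<and> coeffs_in F p"
  unfolding coeffs_in_def by (metis coeff_pCons_0 coeff_pCons_Suc not0_implies_Suc)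

lemma coeffs_in_closed:
  assumes F: "subfield_of_type F"
  shows "coeffs_in F 0" "coeffs_in F 1" "coeffs_in F p \<Longrightarrow> coeffs_in F q \<Longrightarrow> coeffs_in F (p + q)"
    "coeffs_in F p \<Longrightarrow> coeffs_in F q \<Longrightarrow> coeffs_in F (p - q)"
    "coeffs_in F p \<Longrightarrow> coeffs_in F q \<Longrightarrow> coeffs_in F (p * q)"
    "c \<in> F \<Longrightarrow> coeffs_in F p \<Longrightarrow> coeffs_in F (smult c p)" "coeffs_in F p \<Longrightarrow> coeffs_in F (pderiv p)"
  using subfield_closed[OF F]
  by (auto simp: coeffs_in_def coeff_mult coeff_pderiv coeff_1 intro!: subfield_closed(8)[OF F] simp del: of_nat_Suc)

lemma poly_in_subring:
  fixes R :: "'a::field set"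
  assumes R: "1 \<in> R" "\<And>a b. a \<in> R \<Longrightarrow> b \<in> R \<Longrightarrow> a - b \<in> R" "\<And>a b. a \<in> R \<Longrightarrow> b \<in> R \<Longrightarrow> a * b \<in> R"
    and "coeffs_in R p" "a \<in> R"
  shows "poly p a \<in> R"
  using assms(4) by (induction p) (auto intro!: subring_closed[OF R] assms)

section \<open>Minimal polynomials over a subfield\<close>

lemma minimal_poly_exists:
  assumes F: "subfield_of_type F" and g: "coeffs_in F g" "g \<noteq> 0" "poly g a = 0"
  shows "\<exists>q. minimal_poly F a q"
proof -
  let ?P = "\<lambda>g. coeffs_in F g \<and> g \<noteq> 0 \<and> poly g a = 0"
  obtain q where q: "?P q" and min: "\<And>h. ?P h \<Longrightarrow> Polynomial.degree q \<le> Polynomial.degree h"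
    using ex_has_least_nat[of ?P g Polynomial.degree] g by auto
  have "lead_coeff q \<in> F" using q by (simp add: coeffs_in_def)
  then have "minimal_poly F a (smult (inverse (lead_coeff q)) q)"
    using q min by (auto simp: minimal_poly_def coeffs_in_closed[OF F] subfield_closed[OF F])
  then show ?thesis ..
qed

text \<open>Long division by a monic polynomial never divides by a coefficient, so quotient and
  remainder stay over \<open>F\<close>. Each induction step brings in one coefficient and subtracts
  the multiple \<open>c q\<close> that restores the degree bound.\<close>

lemma coeffs_in_division:
  assumes F: "subfield_of_type F" and q: "coeffs_in F q" "lead_coeff q = 1" "Polynomial.degree q > 0"
    and g: "coeffs_in F g"
  shows "\<exists>h r. coeffs_in F h \<and> coeffs_in F r \<and> g = q * h + r \<and> Polynomial.degree r < Polynomial.degree q"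
  using g
proof (induction g)
  case 0
  then show ?case using q(3) by (intro exI[of _ 0]) auto
next
  case (pCons a g)
  then obtain h r where IH: "coeffs_in F h" "coeffs_in F r" "g = q * h + r" "Polynomial.degree r < Polynomial.degree q"
    by auto
  let ?n = "Polynomial.degree q"
  define r' where "r' = pCons a r"
  define c where "c = coeff r' ?n"
  have r': "coeffs_in F r'" using IH pCons by (simp add: r'_def)
  then have c: "c \<in> F" by (simp add: c_def coeffs_in_def)
  have "Polynomial.degree r' \<le> ?n" unfolding r'_def
    using IH(4) degree_pCons_le[of a r] by linarith
  then have "Polynomial.degree (r' - smult c q) \<le> ?n" by (intro degree_diff_le) (auto simp: degree_smult_eq)
  moreover have "coeff (r' - smult c q) ?n = 0" using q(2) by (simp add: c_def)
  ultimately have "Polynomial.degree (r' - smult c q) < ?n"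
    using q(3) by (metis degree_0 eq_zero_or_degree_less)
  moreover have "pCons a g = q * (pCons 0 h + [:c:]) + (r' - smult c q)"
    by (simp add: r'_def IH(3) algebra_simps)
  moreover have "coeffs_in F (pCons 0 h + [:c:])" "coeffs_in F (r' - smult c q)"
    using IH c q r' by (auto intro!: coeffs_in_closed[OF F] subfield_closed[OF F])
  ultimately show ?case by blast
qed

lemma minimal_poly_degree_pos: "minimal_poly F a q \<Longrightarrow> Polynomial.degree q > 0"
  unfolding minimal_poly_def by (metis degree_eq_zeroE gr0I lead_coeff_pCons(2) poly_const_conv zero_neq_one)

lemma minimal_poly_dvd:
  assumes F: "subfield_of_type F" and q: "minimal_poly F a q" and g: "coeffs_in F g" "poly g a = 0"
  obtains h where "coeffs_in F h" "g = q * h"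
proof -
  obtain h r where hr: "coeffs_in F h" "coeffs_in F r" "g = q * h + r" "Polynomial.degree r < Polynomial.degree q"
    using coeffs_in_division[OF F _ _ minimal_poly_degree_pos[OF q] g(1)] q unfolding minimal_poly_def by blast
  then have "poly r a = 0" using g q by (simp add: minimal_poly_def)
  with hr q have "r = 0" unfolding minimal_poly_def by (meson leD)
  with hr that show ?thesis by simp
qed

text \<open>In characteristic 0 the derivative is nonzero, as its coefficient just below the degree
  of \<open>q\<close> shows. Having smaller degree than \<open>q\<close>, it cannot vanish at
  \<open>a\<close>.\<close>

lemma minimal_poly_separable:
  fixes F :: "'a::field set"
  assumes F: "subfield_of_type F" and q: "minimal_poly F a q" and char: "CHAR('a) = 0"
  shows "poly (pderiv q) a \<noteq> 0"
proof
  assume 0: "poly (pderiv q) a = 0"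
  have deg: "Polynomial.degree q > 0" using minimal_poly_degree_pos[OF q] .
  have "coeff (pderiv q) (Polynomial.degree q - 1) = of_nat (Polynomial.degree q)"
    using deg q by (simp add: coeff_pderiv minimal_poly_def del: of_nat_Suc)
  also have "\<dots> \<noteq> 0" using deg char by (simp add: of_nat_eq_0_iff_char_dvd)
  finally have "pderiv q \<noteq> 0" by auto
  with 0 q have "Polynomial.degree q \<le> Polynomial.degree (pderiv q)"
    by (auto simp: minimal_poly_def coeffs_in_closed[OF F])
  moreover have "Polynomial.degree (pderiv q) \<le> Polynomial.degree q - 1"
    by (rule degree_le) (auto simp: coeff_pderiv coeff_eq_0)
  ultimately show False using deg by simp
qed

section \<open>Derivations on a subfield and adjunction of one element\<close>

lemma derivation_on_simps:
  assumes F: "subfield_of_type F" and d: "derivation_on F d"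
  shows "a \<in> F \<Longrightarrow> b \<in> F \<Longrightarrow> d (a + b) = d a + d b"
    "a \<in> F \<Longrightarrow> b \<in> F \<Longrightarrow> d (a * b) = d a * b + a * d b" "d 0 = 0" "d 1 = 0"
proof -
  show add: "d (a + b) = d a + d b" and mult: "d (a * b) = d a * b + a * d b" if "a \<in> F" "b \<in> F" for a b
    using d that by (auto simp: derivation_on_def)
  have "d 0 = d 0 + d 0" using add[of 0 0] subfield_closed(1)[OF F] by simp
  then show "d 0 = 0" by (metis add_0 add_right_cancel)
  have "d 1 = d 1 + d 1" using mult[of 1 1] subfield_closed(2)[OF F] by simp
  then show "d 1 = 0" by (metis add_0 add_right_cancel)
qed

lemma map_poly_derivation_add:
  assumes F: "subfield_of_type F" and d: "derivation_on F d" and "coeffs_in F p" "coeffs_in F q"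
  shows "map_poly d (p + q) = map_poly d p + map_poly d q"
  using assms(3,4) by (intro poly_eqI) (simp add: coeff_map_poly coeffs_in_def derivation_on_simps[OF F d])

lemma map_poly_derivation_mult:
  assumes F: "subfield_of_type F" and d: "derivation_on F d" and "coeffs_in F p" "coeffs_in F q"
  shows "map_poly d (p * q) = map_poly d p * q + p * map_poly d q"
  using assms(3)
proof (induction p)
  case 0
  show ?case by simp
next
  case (pCons a p)
  note simps = derivation_on_simps[OF F d]
  note closed = coeffs_in_closed[OF F] subfield_closed[OF F]
  have aF: "a \<in> F" using pCons.prems by simp
  have smult: "map_poly d (smult a q) = smult (d a) q + smult a (map_poly d q)"
    using aF assms(4) by (intro poly_eqI) (simp add: coeff_map_poly coeffs_in_def simps)
  have pC: "map_poly d (pCons c r) = pCons (d c) (map_poly d r)" for c r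
    by (intro poly_eqI) (auto simp: coeff_map_poly simps coeff_pCons split: nat.split)
  have "map_poly d (pCons a p * q) = map_poly d (smult a q) + map_poly d (pCons 0 (p * q))"
    unfolding mult_pCons_left
    by (rule map_poly_derivation_add[OF F d]) (use pCons.prems assms(4) in \<open>auto intro!: closed\<close>)
  also have "\<dots> = map_poly d (pCons a p) * q + pCons a p * map_poly d q"
    using pCons by (simp add: smult pC simps algebra_simps)
  finally show ?case .
qed

text \<open>The chain rule: \<open>map_poly d\<close> differentiates the coefficients and
  \<open>pderiv\<close> the argument.\<close>

lemma derivation_on_poly:
  assumes F: "subfield_of_type F" and d: "derivation_on F d" and a: "a \<in> F" and "coeffs_in F p"
  shows "d (poly p a) = poly (map_poly d p) a + poly (pderiv p) a * d a"
  using assms(4)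
proof (induction p)
  case 0
  show ?case by (simp add: derivation_on_simps[OF F d])
next
  case (pCons c p)
  note simps = derivation_on_simps[OF F d]
  have pC: "map_poly d (pCons c r) = pCons (d c) (map_poly d r)" for c r
    by (intro poly_eqI) (auto simp: coeff_map_poly simps coeff_pCons split: nat.split)
  have p: "poly p a \<in> F" using pCons.prems a
    by (intro poly_in_subring) (auto simp: subfield_closed[OF F])
  have "d (poly (pCons c p) a) = d c + (d a * poly p a + a * d (poly p a))"
    using p a pCons.prems by (simp add: simps subfield_closed[OF F])
  also have "\<dots> = poly (map_poly d (pCons c p)) a + poly (pderiv (pCons c p)) a * d a"
    using pCons by (simp add: pC pderiv_pCons algebra_simps)
  finally show ?case .
qed

text \<open>The extension lives on \<open>F[a]\<close>, a field because every element is algebraic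
  over \<open>F\<close>. It sends \<open>g(a)\<close> to the value dictated by the chain rule, which
  is consistent because polynomials vanishing at \<open>a\<close> are multiples of the minimal
  polynomial and are sent to 0.\<close>

lemma derivation_on_adjoin:
  fixes F :: "'a::field set"
  assumes F: "subfield_of_type F" and d: "derivation_on F d" and char: "CHAR('a) = 0"
    and alg: "\<And>z. \<exists>g. coeffs_in F g \<and> g \<noteq> 0 \<and> poly g z = 0"
  shows "\<exists>F' d'. subfield_of_type F' \<and> derivation_on F' d' \<and> F \<subseteq> F' \<and> a \<in> F' \<and> (\<forall>z\<in>F. d' z = d z)"
proof -
  note simps = derivation_on_simps[OF F d]
  note closed = coeffs_in_closed[OF F] subfield_closed[OF F]
  obtain q where q: "minimal_poly F a q" using minimal_poly_exists[OF F] alg by blast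
  have sep: "poly (pderiv q) a \<noteq> 0" by (rule minimal_poly_separable[OF F q char])
  \<comment> \<open>The only possible derivative of \<open>a\<close>: the solution \<open>b\<close>
    of the chain rule applied to \<open>q(a) = 0\<close>.\<close>
  define b where "b = - poly (map_poly d q) a / poly (pderiv q) a"
  define val where "val g = poly (map_poly d g) a + poly (pderiv g) a * b" for g
  have val_add: "val (g + h) = val g + val h" if "coeffs_in F g" "coeffs_in F h" for g h
    using that by (simp add: val_def map_poly_derivation_add[OF F d] pderiv_add algebra_simps)
  have val_mult: "val (g * h) = val g * poly h a + poly g a * val h" if "coeffs_in F g" "coeffs_in F h" for g h
    using that by (simp add: val_def map_poly_derivation_mult[OF F d] pderiv_mult algebra_simps)
  have val_0: "val g = 0" if g: "coeffs_in F g" "poly g a = 0" for g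
  proof -
    obtain h where h: "coeffs_in F h" "g = q * h" by (rule minimal_poly_dvd[OF F q g])
    have "val q = 0" using sep by (simp add: val_def b_def)
    with h q show ?thesis by (simp add: val_mult minimal_poly_def)
  qed
  have val_cong: "val g = val h" if "coeffs_in F g" "coeffs_in F h" "poly g a = poly h a" for g h
  proof -
    have "val ((g - h) + h) = val (g - h) + val h" using that by (intro val_add closed)
    moreover have "val (g - h) = 0" using that by (intro val_0 closed) auto
    ultimately show ?thesis by simp
  qed
  define F' where "F' = (\<lambda>g. poly g a) ` {g. coeffs_in F g}"
  define d' where "d' z = val (SOME g. coeffs_in F g \<and> poly g a = z)" for z
  have d': "d' (poly g a) = val g" if "coeffs_in F g" for g
    unfolding d'_def by (rule someI2[of _ g]) (use that in \<open>auto intro: val_cong\<close>)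
  have const: "coeffs_in F [:z:]" if "z \<in> F" for z using that closed(1) by simp
  have FF': "F \<subseteq> F'" 
  proof
    fix z assume "z \<in> F"
    then have "coeffs_in F [:z:]" "z = poly [:z:] a" using const by simp_all
    then show "z \<in> F'" unfolding F'_def by blast
  qed
  have aF': "a \<in> F'" unfolding F'_def image_iff
    by (rule bexI[of _ "[:0, 1:]"]) (simp_all add: closed)
  have minus: "x - y \<in> F'" if "x \<in> F'" "y \<in> F'" for x y
    using that closed(4) unfolding F'_def by (auto simp: image_iff) (metis poly_diff)
  have times: "x * y \<in> F'" if "x \<in> F'" "y \<in> F'" for x y
    using that closed(5) unfolding F'_def by (auto simp: image_iff) (metis poly_mult)
  have one: "1 \<in> F'" using FF' closed by blast
  have "inverse z \<in> F'" if z: "z \<in> F'" for z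
  proof (cases "z = 0")
    case True
    with z show ?thesis by simp
  next
    case False
    obtain g where g: "minimal_poly F z g" using minimal_poly_exists[OF F] alg by blast
    \<comment> \<open>With the minimal polynomial of \<open>z\<close> written as
      \<open>c + x g'(x)\<close>, minimality gives \<open>c \<noteq> 0\<close>, so
      \<open>1/z = - g'(z)/c\<close> is a polynomial expression in \<open>z\<close>.\<close>
    obtain c g' where g': "g = pCons c g'" by (cases g)
    have root: "c + z * poly g' z = 0" using g by (simp add: minimal_poly_def g')
    have "c \<noteq> 0"
    proof
      assume "c = 0"
      with root False have "poly g' z = 0" by simp
      moreover have "g' \<noteq> 0" using minimal_poly_degree_pos[OF g] g' by auto
      ultimately show False using g unfolding minimal_poly_def g' by fastforce
    qed
    have "coeffs_in F g'" using g by (simp add: minimal_poly_def g')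
    then have "coeffs_in F' g'" using FF' by (auto simp: coeffs_in_def)
    then have "poly g' z \<in> F'" using z by (intro poly_in_subring one minus times)
    moreover have "- inverse c \<in> F'" using g FF' closed by (auto simp: minimal_poly_def g' coeffs_in_pCons)
    moreover have "inverse z = - inverse c * poly g' z"
      using root \<open>c \<noteq> 0\<close> False by (simp add: field_simps eq_neg_iff_add_eq_0)
    ultimately show ?thesis by (simp only: times)
  qed
  then have "subfield_of_type F'" using one minus times by (simp add: subfield_of_type_def)
  moreover have "derivation_on F' d'"
    unfolding derivation_on_def
  proof (intro ballI)
    fix x y assume "x \<in> F'" "y \<in> F'"
    then obtain g h where gh: "coeffs_in F g" "x = poly g a" "coeffs_in F h" "y = poly h a"
      by (auto simp: F'_def)
    have "d' (x + y) = val (g + h)" "d' (x * y) = val (g * h)"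
      using d'[of "g + h"] d'[of "g * h"] closed gh by simp_all
    then show "d' (x + y) = d' x + d' y \<and> d' (x * y) = d' x * y + x * d' y"
      using gh by (simp add: d' val_add val_mult)
  qed
  moreover have "d' z = d z" if "z \<in> F" for z
    using d'[OF const[OF that]] by (simp add: val_def map_poly_pCons simps)
  ultimately show ?thesis using FF' aF' by blast
qed

section \<open>Passage to the algebraic closure\<close>

lemma subfield_range_to_ac: "subfield_of_type (range to_ac)"
  unfolding subfield_of_type_def
  by (auto simp flip: to_ac_diff to_ac_mult to_ac_inverse to_ac_1 simp del: to_ac_1)

lemma coeffs_in_range_to_ac_map: "coeffs_in (range to_ac) (map_poly to_ac p)"
  by (simp add: coeffs_in_def coeff_map_poly)

lemma algebraic_over_range_to_ac: "\<exists>g. coeffs_in (range to_ac) g \<and> g \<noteq> 0 \<and> poly g z = 0"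
  using alg_closure_algebraic[of z]
  by (metis coeffs_in_range_to_ac_map map_poly_eq_0_iff to_ac_0 to_ac_eq_0_iff)

text \<open>Minimal polynomials force the value \<open>D z\<close> at each \<open>z\<close> separately. To see that this \<open>D\<close> is a derivation
  at \<open>x\<close> and \<open>y\<close>, it suffices to extend \<open>\<delta>\<close> to the subfield generated by \<open>x\<close> and \<open>y\<close>, so no maximal extension
  is needed.\<close>

theorem derivation_alg_closure_unique:
  fixes \<delta> :: "'k::field \<Rightarrow> 'k"
  assumes \<delta>: "derivation \<delta>" and char: "CHAR('k) = 0"
  shows "\<exists>!D. derivation D \<and> (\<forall>r. D (to_ac r) = to_ac (\<delta> r))"
proof -
  define K where "K = (range to_ac :: 'k alg_closure set)"
  define d0 where "d0 z = to_ac (\<delta> (of_ac z))" for z :: "'k alg_closure"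
  have K: "subfield_of_type K" unfolding K_def by (rule subfield_range_to_ac)
  have d0 [simp]: "d0 (to_ac r) = to_ac (\<delta> r)" for r by (simp add: d0_def)
  have d0K: "derivation_on K d0" using derivation_simps[OF \<delta>]
    by (auto simp: derivation_on_def K_def simp flip: to_ac_add to_ac_mult)
  have char': "CHAR('k alg_closure) = 0" using char by simp
  have alg: "\<exists>g. coeffs_in F g \<and> g \<noteq> 0 \<and> poly g z = 0" if "K \<subseteq> F" for F z
    using algebraic_over_range_to_ac[of z] that unfolding coeffs_in_def K_def by blast
  define q where "q z = (SOME q. minimal_poly K z q)" for z
  have q: "minimal_poly K z (q z)" for z
    unfolding q_def by (rule someI_ex) (use minimal_poly_exists[OF K] alg[of K] in blast)
  define D where "D z = - poly (map_poly d0 (q z)) z / poly (pderiv (q z)) z" for z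
  \<comment> \<open>Every derivation extending \<open>d0\<close> to an intermediate field is given
    by \<open>D\<close>. For \<open>K\<close> this yields the prescribed values, for a field
    containing \<open>x\<close> and \<open>y\<close> the sum and product rules, and for the whole
    closure uniqueness.\<close>
  have D: "d z = D z" if F: "subfield_of_type F" "derivation_on F d" "K \<subseteq> F" and d: "\<And>z. z \<in> K \<Longrightarrow> d z = d0 z"
    and z: "z \<in> F" for F d z
  proof -
    have K': "coeff (q z) i \<in> K" for i using q[of z] by (simp add: minimal_poly_def coeffs_in_def)
    then have "coeffs_in F (q z)" using F(3) by (auto simp: coeffs_in_def)
    then have "d (poly (q z) z) = poly (map_poly d (q z)) z + poly (pderiv (q z)) z * d z"
      by (rule derivation_on_poly[OF F(1,2) z])
    moreover have "map_poly d (q z) = map_poly d0 (q z)"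
      using derivation_on_simps(3)[OF F(1,2)] derivation_on_simps(3)[OF K d0K] K' d
      by (intro poly_eqI) (simp add: coeff_map_poly)
    moreover have "d (poly (q z) z) = 0"
      using derivation_on_simps(3)[OF F(1,2)] q[of z] by (simp add: minimal_poly_def)
    moreover have "poly (pderiv (q z)) z \<noteq> 0" by (rule minimal_poly_separable[OF K q char'])
    ultimately show ?thesis by (simp add: D_def field_simps eq_neg_iff_add_eq_0)
  qed
  have "derivation D \<and> (\<forall>r. D (to_ac r) = to_ac (\<delta> r))"
  proof (intro conjI allI)
    show "D (to_ac r) = to_ac (\<delta> r)" for r
      using D[OF K d0K order_refl refl, of "to_ac r"] by (simp add: K_def)
    show "derivation D" unfolding derivation_def
    proof (intro conjI allI)
      fix x y
      obtain F1 d1 where 1: "subfield_of_type F1" "derivation_on F1 d1" "K \<subseteq> F1" "x \<in> F1" "\<forall>z\<in>K. d1 z = d0 z"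
        using derivation_on_adjoin[OF K d0K char' alg[OF order_refl]] by blast
      obtain F2 d2 where 2: "subfield_of_type F2" "derivation_on F2 d2" "F1 \<subseteq> F2" "y \<in> F2" "\<forall>z\<in>F1. d2 z = d1 z"
        using derivation_on_adjoin[OF 1(1,2) char' alg[OF 1(3)]] by blast
      have "d2 z = D z" if "z \<in> F2" for z
        using D[OF 2(1,2) _ _ that] 1 2 by (metis subset_iff)
      moreover have "x \<in> F2" "y \<in> F2" using 1 2 by auto
      ultimately show "D (x + y) = D x + D y" "D (x * y) = D x * y + x * D y"
        using 2(2) subfield_closed[OF 2(1)] unfolding derivation_on_def by metis+
    qed
  qed
  moreover have "D' = D" if D': "derivation D' \<and> (\<forall>r. D' (to_ac r) = to_ac (\<delta> r))" for D'
  proof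
    fix z
    show "D' z = D z" using D'
      by (intro D[of UNIV]) (auto simp: subfield_of_type_def derivation_on_def derivation_def K_def)
  qed
  ultimately show ?thesis by blast
qed

lemma CHAR_ratfun: "CHAR('n::{finite,linorder} ratfun) = 0"
proof (rule CHAR_eqI)
  fix k assume "of_nat k = (0 :: 'n ratfun)"
  moreover have "of_nat k = frac (of_nat k :: ('n, complex) mpoly)"
    by (simp add: frac_def of_nat_fract)
  ultimately show "0 dvd k" by simp
qed simp

lemma algfun_deriv:
  shows "derivation (algfun_deriv j)" "algfun_deriv j (to_ac r) = to_ac (ratfun_deriv j r)"
  using theI'[OF derivation_alg_closure_unique[OF derivation_ratfun_deriv CHAR_ratfun, of j]]
  unfolding algfun_deriv_def[symmetric] by auto

section \<open>Ideals and normal forms\<close>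

lemma module_times: "Modules.module ((*) :: 'a::comm_ring_1 \<Rightarrow> 'a \<Rightarrow> 'a)"
  by (rule Modules.module.intro) (simp_all add: algebra_simps)

lemma ideal_gen_closed:
  fixes S :: "'a::comm_ring_1 set"
  shows "0 \<in> ideal_gen S" "a \<in> ideal_gen S \<Longrightarrow> b \<in> ideal_gen S \<Longrightarrow> a + b \<in> ideal_gen S"
    "a \<in> ideal_gen S \<Longrightarrow> c * a \<in> ideal_gen S" "a \<in> S \<Longrightarrow> a \<in> ideal_gen S"
  unfolding ideal_gen_def
  by (fact module.span_zero[OF module_times] module.span_add[OF module_times]
      module.span_scale[OF module_times] module.span_base[OF module_times])+

lemma ideal_gen_induct [consumes 1, case_names zero add]:
  fixes S :: "'a::comm_ring_1 set"
  assumes "a \<in> ideal_gen S" "P 0" "\<And>c s b. s \<in> S \<Longrightarrow> P b \<Longrightarrow> P (c * s + b)"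
  shows "P a"
  using module.span_induct_alt[OF module_times assms(1)[unfolded ideal_gen_def], of P] assms(2,3) by blast

definition is_ideal :: "'a::comm_ring_1 set \<Rightarrow> bool" where
  "is_ideal \<I> \<longleftrightarrow> 0 \<in> \<I> \<and> (\<forall>a\<in>\<I>. \<forall>b\<in>\<I>. a + b \<in> \<I>) \<and> (\<forall>a\<in>\<I>. \<forall>c. c * a \<in> \<I>)"

lemma is_ideal_ideal_gen: "is_ideal (ideal_gen S)"
  by (simp add: is_ideal_def ideal_gen_closed)

lemma is_idealD:
  assumes "is_ideal \<I>"
  shows "0 \<in> \<I>" "a \<in> \<I> \<Longrightarrow> b \<in> \<I> \<Longrightarrow> a + b \<in> \<I>" "a \<in> \<I> \<Longrightarrow> c * a \<in> \<I>" "a \<in> \<I> \<Longrightarrow> a * c \<in> \<I>"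
    "a \<in> \<I> \<Longrightarrow> - a \<in> \<I>" "a \<in> \<I> \<Longrightarrow> b \<in> \<I> \<Longrightarrow> a - b \<in> \<I>"
    "(\<And>i. i \<in> A \<Longrightarrow> f i \<in> \<I>) \<Longrightarrow> sum f A \<in> \<I>"
proof -
  show 0: "0 \<in> \<I>" and add: "a \<in> \<I> \<Longrightarrow> b \<in> \<I> \<Longrightarrow> a + b \<in> \<I>" and mult: "a \<in> \<I> \<Longrightarrow> c * a \<in> \<I>" for a b c
    using assms by (auto simp: is_ideal_def)
  then show "a \<in> \<I> \<Longrightarrow> a * c \<in> \<I>" by (simp add: mult.commute)
  show neg: "- a \<in> \<I>" if "a \<in> \<I>" for a using mult[OF that, of "- 1"] by simp
  show "a \<in> \<I> \<Longrightarrow> b \<in> \<I> \<Longrightarrow> a - b \<in> \<I>" using add[of a "- b"] neg by simp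
  show "(\<And>i. i \<in> A \<Longrightarrow> f i \<in> \<I>) \<Longrightarrow> sum f A \<in> \<I>"
    by (induction A rule: infinite_finite_induct) (auto intro: 0 add)
qed

lemma lookup_single_times:
  "Poly_Mapping.lookup (Poly_Mapping.single s c * p) (s + t) = c * Poly_Mapping.lookup (p :: ('v, 'a::comm_semiring_1) mpoly) t"
proof (induction p rule: mpoly_single_induct)
  case (single u d)
  show ?case by (simp add: mult_single lookup_single when_def)
qed (simp add: distrib_left lookup_add)

lemma lookup_mconst_times:
  "Poly_Mapping.lookup (mconst c * p) t = c * Poly_Mapping.lookup (p :: ('v, 'a::comm_semiring_1) mpoly) t"
  using lookup_single_times[of 0 c p t] by (simp add: mconst_def)

lemma keys_single_times_subset:
  "Poly_Mapping.keys (Poly_Mapping.single s c * (p :: ('v, 'a::comm_semiring_1) mpoly)) \<subseteq> (\<lambda>t. s + t) ` Poly_Mapping.keys p"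
  using keys_mult[of "Poly_Mapping.single s c" p] by (cases "c = 0") auto

text \<open>Multiplying a term by a polynomial yields only multiples of its monomial, and addition
  creates no new monomials. This is applied to ideals of leading terms.\<close>

lemma keys_ideal_gen_monomials:
  fixes S :: "('v, 'a::comm_ring_1) mpoly set"
  assumes S: "\<And>s. s \<in> S \<Longrightarrow> \<exists>t c. s = Poly_Mapping.single t c \<and> t \<in> M"
    and "p \<in> ideal_gen S" "k \<in> Poly_Mapping.keys p"
  shows "\<exists>t\<in>M. \<exists>u. k = t + u"
  using assms(2,3)
proof (induction p rule: ideal_gen_induct)
  case zero
  then show ?case by simp
next
  case (add q s b)
  obtain t c where s: "s = Poly_Mapping.single t c" "t \<in> M" using S[OF add(1)] by blast
  have "k \<in> Poly_Mapping.keys (s * q) \<union> Poly_Mapping.keys b"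
    using add.prems Poly_Mapping.keys_add[of "q * s" b] by (auto simp: mult.commute)
  then show ?case using add.IH keys_single_times_subset[of t c q] s by fastforce
qed

section \<open>Division with remainder and standard monomials\<close>

lemma division_remainderE:
  assumes "division_remainder mle G h r"
  obtains q where "h = (\<Sum>g\<in>G. q g * g) + r"
    "\<And>g t. g \<in> G \<Longrightarrow> t \<in> Poly_Mapping.keys (q g * g) \<Longrightarrow> \<exists>s\<in>Poly_Mapping.keys h. mle t s"
    "Poly_Mapping.keys r \<subseteq> standard_monoms mle G"
proof -
  from assms obtain q where q: "h = (\<Sum>g\<in>G. q g * g) + r \<and>
      (\<forall>g\<in>G. \<forall>t\<in>Poly_Mapping.keys (q g * g). \<exists>s\<in>Poly_Mapping.keys h. mle t s)"
    and r: "Poly_Mapping.keys r \<subseteq> standard_monoms mle G"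
    unfolding division_remainder_def by (elim conjE exE) (rule that, intro conjI)
  show ?thesis by (rule that[of q]) (fact conjunct1[OF q], use conjunct2[OF q] in blast, fact r)
qed

locale monomial_order =
  fixes mle :: "'v monom \<Rightarrow> 'v monom \<Rightarrow> bool"
  assumes ordering: "monomial_ordering mle"
begin

lemma mle_linear: "mle s t \<or> mle t s"
  and mle_trans: "mle s t \<Longrightarrow> mle t u \<Longrightarrow> mle s u"
  and mle_antisym: "mle s t \<Longrightarrow> mle t s \<Longrightarrow> s = t"
  and mle_refl: "mle s s"
  and mle_add: "mle s t \<Longrightarrow> mle (s + u) (t + u)"
  and wfp_mlt: "wfp (\<lambda>s t. mle s t \<and> \<not> mle t s)"
proof -
  interpret wellorder mle "\<lambda>s t. mle s t \<and> \<not> mle t s"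
    using ordering by (simp add: monomial_ordering_def)
  show "mle s t \<or> mle t s" "mle s t \<Longrightarrow> mle t u \<Longrightarrow> mle s u" "mle s t \<Longrightarrow> mle t s \<Longrightarrow> s = t" "mle s s"
    by (auto intro: linear order.trans antisym)
  show "wfp (\<lambda>s t. mle s t \<and> \<not> mle t s)" by (rule wfp_on_less)
  show "mle s t \<Longrightarrow> mle (s + u) (t + u)" using ordering by (simp add: monomial_ordering_def)
qed

lemma finite_has_max: "finite A \<Longrightarrow> A \<noteq> {} \<Longrightarrow> \<exists>t\<in>A. \<forall>s\<in>A. mle s t"
proof (induction A rule: finite_ne_induct)
  case (insert x A)
  then obtain t where t: "t \<in> A" "\<forall>s\<in>A. mle s t" by blast
  then show ?case using mle_linear[of x t] mle_trans mle_refl by (metis insert_iff)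
qed (simp add: mle_refl)

lemma lead_monom:
  assumes "q \<noteq> 0"
  shows "lead_monom mle q \<in> Poly_Mapping.keys q" "s \<in> Poly_Mapping.keys q \<Longrightarrow> mle s (lead_monom mle q)"
proof -
  have "\<exists>!t. t \<in> Poly_Mapping.keys q \<and> (\<forall>s\<in>Poly_Mapping.keys q. mle s t)"
    using finite_has_max[of "Poly_Mapping.keys q"] assms by (metis finite_keys keys_eq_empty mle_antisym)
  from theI'[OF this] show "lead_monom mle q \<in> Poly_Mapping.keys q"
    "s \<in> Poly_Mapping.keys q \<Longrightarrow> mle s (lead_monom mle q)" unfolding lead_monom_def by auto
qed

text \<open>One reduction step. The bound on the quotients survives because every monomial of
  \<open>h' = h - p g\<close> already lies below some monomial of \<open>h\<close>.\<close>

lemma division_remainder_add_multiple: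
  assumes fin: "finite G" and g: "g \<in> G" and rem: "division_remainder mle G h' r" and h: "h = h' + p * g"
    and le: "\<And>t. t \<in> Poly_Mapping.keys (p * g) \<Longrightarrow> \<exists>s\<in>Poly_Mapping.keys h. mle t s"
  shows "division_remainder mle G h r"
proof -
  obtain q where q: "h' = (\<Sum>g\<in>G. q g * g) + r"
    "\<And>g t. g \<in> G \<Longrightarrow> t \<in> Poly_Mapping.keys (q g * g) \<Longrightarrow> \<exists>s\<in>Poly_Mapping.keys h'. mle t s"
    and r: "Poly_Mapping.keys r \<subseteq> standard_monoms mle G"
    by (rule division_remainderE[OF rem]) blast
  define q' where "q' = q(g := q g + p)"
  have h'le: "\<exists>s'\<in>Poly_Mapping.keys h. mle s s'" if "s \<in> Poly_Mapping.keys h'" for s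
  proof -
    have "h' = h - p * g" by (simp add: h)
    with that have "s \<in> Poly_Mapping.keys h \<union> Poly_Mapping.keys (p * g)"
      using keys_diff[of h "p * g"] by auto
    then show ?thesis using le mle_refl by blast
  qed
  have "(\<Sum>k\<in>G. q' k * k) = (\<Sum>k\<in>G. q k * k + (if k = g then p * g else 0))"
    by (rule sum.cong) (auto simp: q'_def algebra_simps)
  also have "\<dots> = (\<Sum>k\<in>G. q k * k) + p * g" using fin g by (simp add: sum.distrib)
  finally have "h = (\<Sum>k\<in>G. q' k * k) + r" using q(1) h by simp
  moreover have "\<exists>s\<in>Poly_Mapping.keys h. mle t s" if k: "k \<in> G" "t \<in> Poly_Mapping.keys (q' k * k)" for k t
  proof -
    have "t \<in> Poly_Mapping.keys (q k * k) \<or> t \<in> Poly_Mapping.keys (p * g)"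
      using k(2) Poly_Mapping.keys_add[of "q g * g" "p * g"] by (auto simp: q'_def algebra_simps split: if_splits)
    then show ?thesis using q(2)[OF k(1)] le h'le mle_trans by blast
  qed
  ultimately show ?thesis unfolding division_remainder_def
    by (intro conjI exI[of _ q'] r) blast+
qed

lemma division_remainder_exists:
  fixes G :: "('v, 'k::field) mpoly set"
  assumes fin: "finite G"
  shows "\<exists>r. division_remainder mle G h r"
proof -
  \<comment> \<open>The induction runs over a bound \<open>t\<close> for the monomials instead of
    the leading monomial, which includes \<open>h = 0\<close>. If \<open>t\<close> occurs in
    \<open>h\<close>, it is either moved to the remainder or cancelled by a multiple of some
    \<open>g\<close>.\<close>
  have "\<forall>h. (\<forall>s\<in>Poly_Mapping.keys h. mle s t) \<longrightarrow> (\<exists>r. division_remainder mle G h r)" for t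
  proof (induction t rule: wfp_induct_rule[OF wfp_mlt])
    case (1 t)
    show ?case
    proof (intro allI impI)
      fix h :: "('v, 'k) mpoly"
      assume le: "\<forall>s\<in>Poly_Mapping.keys h. mle s t"
      have smaller: "\<exists>r. division_remainder mle G h' r"
        if h': "\<forall>s\<in>Poly_Mapping.keys h'. mle s t" "t \<notin> Poly_Mapping.keys h'" for h' :: "('v, 'k) mpoly"
      proof (cases "h' = 0")
        case True
        have "division_remainder mle G 0 0" unfolding division_remainder_def
          by (intro conjI exI[of _ "\<lambda>_. 0"]) auto
        then show ?thesis using True by blast
      next
        case False
        let ?s = "lead_monom mle h'"
        have "mle ?s t \<and> \<not> mle t ?s" using lead_monom[OF False] h' mle_antisym by metis
        then show ?thesis using 1 lead_monom(2)[OF False] by blast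
      qed
      show "\<exists>r. division_remainder mle G h r"
      proof (cases "t \<in> Poly_Mapping.keys h")
        case False
        with le smaller show ?thesis by blast
      next
        case t: True
        let ?c = "Poly_Mapping.lookup h t"
        show ?thesis
        proof (cases "t \<in> standard_monoms mle G")
          case True
          define h' where "h' = h - Poly_Mapping.single t ?c"
          have keys: "Poly_Mapping.keys h' = Poly_Mapping.keys h - {t}"
            by (auto simp: h'_def in_keys_iff lookup_minus lookup_single when_def split: if_splits)
          then have "\<forall>s\<in>Poly_Mapping.keys h'. mle s t" "t \<notin> Poly_Mapping.keys h'" using le by auto
          then obtain r where r: "division_remainder mle G h' r" using smaller by blast
          obtain q where q: "h' = (\<Sum>g\<in>G. q g * g) + r"
            "\<And>g t. g \<in> G \<Longrightarrow> t \<in> Poly_Mapping.keys (q g * g) \<Longrightarrow> \<exists>s\<in>Poly_Mapping.keys h'. mle t s"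
            and r: "Poly_Mapping.keys r \<subseteq> standard_monoms mle G"
            by (rule division_remainderE[OF r]) blast
          have "h = (\<Sum>g\<in>G. q g * g) + (r + Poly_Mapping.single t ?c)"
            using q(1) by (simp add: h'_def algebra_simps)
          moreover have "Poly_Mapping.keys (r + Poly_Mapping.single t ?c) \<subseteq> standard_monoms mle G"
            using Poly_Mapping.keys_add[of r "Poly_Mapping.single t ?c"] r True by (auto split: if_splits)
          moreover have "\<forall>g\<in>G. \<forall>t\<in>Poly_Mapping.keys (q g * g). \<exists>s\<in>Poly_Mapping.keys h. mle t s"
            using q(2) keys by blast
          ultimately have "division_remainder mle G h (r + Poly_Mapping.single t ?c)"
            unfolding division_remainder_def by (intro conjI exI)
          then show ?thesis ..
        next
          case False
          then obtain g u where g: "g \<in> G" "g \<noteq> 0" "t = u + lead_monom mle g"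
            unfolding standard_monoms_def by (auto simp: add.commute)
          let ?lc = "Poly_Mapping.lookup g (lead_monom mle g)"
          have lc: "?lc \<noteq> 0" using lead_monom(1)[OF g(2)] by (simp add: in_keys_iff)
          \<comment> \<open>Chosen so that the leading term of \<open>p g\<close> is the term of
            \<open>h\<close> at \<open>t\<close>.\<close>
          define p where "p = Poly_Mapping.single u (?c / ?lc)"
          have pg: "mle s t" if "s \<in> Poly_Mapping.keys (p * g)" for s
          proof -
            from that obtain s' where "s' \<in> Poly_Mapping.keys g" "s = u + s'"
              using keys_single_times_subset[of u "?c / ?lc" g] by (auto simp: p_def)
            then show ?thesis using mle_add[OF lead_monom(2)[OF g(2)], of s' u] by (simp add: g(3) add.commute)
          qed
          have "Poly_Mapping.lookup (p * g) t = ?c"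
            unfolding p_def g(3) lookup_single_times using lc by (simp add: g(3))
          then have "t \<notin> Poly_Mapping.keys (h - p * g)" by (simp add: in_keys_iff lookup_minus)
          moreover have "\<forall>s\<in>Poly_Mapping.keys (h - p * g). mle s t"
            using keys_diff[of h "p * g"] le pg by blast
          ultimately obtain r where "division_remainder mle G (h - p * g) r" using smaller by blast
          then have "division_remainder mle G h r"
            by (rule division_remainder_add_multiple[OF fin g(1), where p = p]) (use pg t in auto)
          then show ?thesis ..
        qed
      qed
    qed
  qed
  moreover have "\<exists>t. \<forall>s\<in>Poly_Mapping.keys h. mle s t" using lead_monom(2)[of h] by (cases "h = 0") auto
  ultimately show ?thesis by blast
qed

text \<open>Equality of the two leading term ideals would make the leading monomial of a nonzero
  \<open>r\<close> a multiple of the leading monomial of an element of \<open>G\<close>, although it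
  is standard.\<close>

lemma standard_in_ideal_eq_0:
  assumes groebner: "groebner_basis mle \<I> G" and r: "r \<in> \<I>" "Poly_Mapping.keys r \<subseteq> standard_monoms mle G"
  shows "r = 0"
proof (rule ccontr)
  assume "r \<noteq> 0"
  then have "lead_term mle r \<in> ideal_gen (lead_term mle ` (\<I> - {0}))"
    using r(1) by (intro ideal_gen_closed) auto
  then have "lead_term mle r \<in> ideal_gen (lead_term mle ` (G - {0}))"
    using groebner by (simp add: groebner_basis_def)
  moreover have "lead_monom mle r \<in> Poly_Mapping.keys (lead_term mle r)"
    using lead_monom(1)[OF \<open>r \<noteq> 0\<close>] by (simp add: lead_term_def in_keys_iff)
  ultimately have "\<exists>t\<in>lead_monom mle ` (G - {0}). \<exists>u. lead_monom mle r = t + u"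
    by (rule keys_ideal_gen_monomials[rotated]) (auto simp: lead_term_def)
  moreover have "lead_monom mle r \<in> standard_monoms mle G" using lead_monom(1)[OF \<open>r \<noteq> 0\<close>] r(2) by blast
  ultimately show False by (auto simp: standard_monoms_def)
qed

end

locale groebner = monomial_order mle
  for mle :: "'v monom \<Rightarrow> 'v monom \<Rightarrow> bool" +
  fixes \<I> G :: "('v, 'k::field) mpoly set"
  assumes ideal: "is_ideal \<I>" and groebner: "groebner_basis mle \<I> G"
begin

lemma division_remainder_diff_in_ideal:
  assumes "division_remainder mle G h r"
  shows "h - r \<in> \<I>"
proof -
  obtain q where "h = (\<Sum>g\<in>G. q g * g) + r" using assms by (auto simp: division_remainder_def)
  then have "h - r = (\<Sum>g\<in>G. q g * g)" by simp
  also have "\<dots> \<in> \<I>" using groebner by (intro is_idealD[OF ideal]) (auto simp: groebner_basis_def)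
  finally show ?thesis .
qed

lemma eq_of_diff_in_ideal:
  assumes "r - r' \<in> \<I>" "Poly_Mapping.keys r \<subseteq> standard_monoms mle G" "Poly_Mapping.keys r' \<subseteq> standard_monoms mle G"
  shows "r = r'"
proof -
  have "Poly_Mapping.keys (r - r') \<subseteq> standard_monoms mle G" using keys_diff[of r r'] assms(2,3) by blast
  from standard_in_ideal_eq_0[OF groebner assms(1) this] show ?thesis by simp
qed

lemma normal_form_remainder: "division_remainder mle G h (normal_form mle G h)"
proof -
  have "\<exists>!r. division_remainder mle G h r"
  proof (rule ex_ex1I)
    show "\<exists>r. division_remainder mle G h r"
      by (rule division_remainder_exists) (use groebner in \<open>simp add: groebner_basis_def\<close>)
  next
    fix r r' assume r: "division_remainder mle G h r" "division_remainder mle G h r'"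
    have "(h - r') - (h - r) \<in> \<I>" using r by (intro is_idealD(6)[OF ideal] division_remainder_diff_in_ideal)
    then show "r = r'" using r by (intro eq_of_diff_in_ideal) (auto simp: division_remainder_def)
  qed
  from theI'[OF this] show ?thesis by (simp add: normal_form_def)
qed

lemma normal_form_diff_in_ideal: "h - normal_form mle G h \<in> \<I>"
  by (rule division_remainder_diff_in_ideal[OF normal_form_remainder])

lemma keys_normal_form: "Poly_Mapping.keys (normal_form mle G h) \<subseteq> standard_monoms mle G"
  using normal_form_remainder[of h] by (simp add: division_remainder_def)

text \<open>Characterises the normal form by congruence and standard monomials, so that its
  linearity reduces to closure properties of the ideal.\<close>

lemma normal_form_unique:
  assumes "h - r \<in> \<I>" "Poly_Mapping.keys r \<subseteq> standard_monoms mle G"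
  shows "normal_form mle G h = r"
proof (rule eq_of_diff_in_ideal[OF _ keys_normal_form assms(2)])
  have "normal_form mle G h - r = (h - r) - (h - normal_form mle G h)" by simp
  also have "\<dots> \<in> \<I>" by (rule is_idealD(6)[OF ideal assms(1) normal_form_diff_in_ideal])
  finally show "normal_form mle G h - r \<in> \<I>" .
qed

lemma normal_form_add: "normal_form mle G (h + k) = normal_form mle G h + normal_form mle G k"
proof (rule normal_form_unique)
  have "h + k - (normal_form mle G h + normal_form mle G k) = (h - normal_form mle G h) + (k - normal_form mle G k)"
    by simp
  also have "\<dots> \<in> \<I>" by (intro is_idealD(2)[OF ideal] normal_form_diff_in_ideal)
  finally show "h + k - (normal_form mle G h + normal_form mle G k) \<in> \<I>" .
  show "Poly_Mapping.keys (normal_form mle G h + normal_form mle G k) \<subseteq> standard_monoms mle G"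
    using Poly_Mapping.keys_add[of "normal_form mle G h" "normal_form mle G k"]
      keys_normal_form[of h] keys_normal_form[of k] by blast
qed

lemma normal_form_scale: "normal_form mle G (mconst c * h) = mconst c * normal_form mle G h"
proof (rule normal_form_unique)
  have "mconst c * h - mconst c * normal_form mle G h = mconst c * (h - normal_form mle G h)"
    by (simp add: algebra_simps)
  also have "\<dots> \<in> \<I>" by (intro is_idealD(3)[OF ideal] normal_form_diff_in_ideal)
  finally show "mconst c * h - mconst c * normal_form mle G h \<in> \<I>" .
  show "Poly_Mapping.keys (mconst c * normal_form mle G h) \<subseteq> standard_monoms mle G"
    using keys_single_times_subset[of 0 c "normal_form mle G h"] keys_normal_form[of h] by (auto simp: mconst_def)
qed

lemma normal_form_ideal: "h \<in> \<I> \<Longrightarrow> normal_form mle G h = 0"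
  by (rule normal_form_unique) simp_all

lemma normal_form_standard:
  "t \<in> standard_monoms mle G \<Longrightarrow> normal_form mle G (Poly_Mapping.single t c) = Poly_Mapping.single t c"
  by (rule normal_form_unique) (simp_all add: is_idealD(1)[OF ideal])

end

section \<open>Univariate polynomials in a zero-dimensional radical ideal\<close>

definition univariate :: "'v \<Rightarrow> 'a::comm_ring_1 poly \<Rightarrow> ('v, 'a) mpoly" where
  "univariate i p = poly (map_poly mconst p) (mvar i)"

lemma univariate_simps:
  "univariate i 0 = 0" "univariate i (pCons a p) = mconst a + mvar i * univariate i p"
  by (simp_all add: univariate_def map_poly_pCons mconst_simps)

lemma univariate_add: "univariate (i :: 'v) (p + q :: 'a::comm_ring_1 poly) = univariate i p + univariate i q"
proof -
  have "map_poly mconst (p + q) = map_poly mconst p + (map_poly mconst q :: ('v, 'a) mpoly poly)"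
    by (intro poly_eqI) (simp add: coeff_map_poly mconst_simps)
  then show ?thesis by (simp add: univariate_def)
qed

lemma univariate_smult: "univariate (i :: 'v) (smult c p :: 'a::comm_ring_1 poly) = mconst c * univariate i p"
proof -
  have "map_poly mconst (smult c p) = smult (mconst c) (map_poly mconst p :: ('v, 'a) mpoly poly)"
    by (intro poly_eqI) (simp add: coeff_map_poly mconst_simps)
  then show ?thesis by (simp add: univariate_def)
qed

lemma univariate_mult: "univariate i (p * q) = univariate i p * univariate i q"
  by (induction p) (simp_all add: univariate_simps univariate_add univariate_smult mconst_simps algebra_simps)

lemma univariate_hom: "comm_ring_hom (univariate i)"
proof (rule comm_ring_homI)
  show "univariate i 1 = 1" by (simp add: one_pCons univariate_simps mconst_simps)
qed (simp_all add: univariate_add univariate_mult)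

lemma univariate_monom: "univariate i (Polynomial.monom c k) = mconst c * mvar i ^ k"
  by (simp add: univariate_def map_poly_monom mconst_simps poly_monom)

lemma mpeval_univariate: "mpeval to_ac \<xi> (univariate i p) = poly (map_poly to_ac p) (\<xi> i)"
proof -
  interpret to_ac: comm_ring_hom to_ac by (rule to_ac_hom)
  show ?thesis
  proof (induction p)
    case 0
    show ?case by (simp add: univariate_simps mpeval_def)
  next
    case (pCons a p)
    then show ?case
      by (simp add: univariate_simps to_ac.mpeval_add to_ac.mpeval_mult to_ac.mpeval_mvar mpeval_mconst map_poly_pCons)
  qed
qed

text \<open>Modulo the ideal, the powers of \<open>mvar i\<close> have representatives in the span
  of a finite set \<open>B\<close>. The first \<open>card B + 1\<close> representatives satisfy a
  linear relation, whose coefficients form \<open>p\<close>.\<close>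

lemma exists_univariate_in_ideal:
  fixes \<I> :: "('v::finite, 'k::field) mpoly set"
  assumes ideal: "is_ideal \<I>" and zero_dim: "zero_dimensional \<I>"
  shows "\<exists>p. p \<noteq> 0 \<and> univariate i p \<in> \<I>"
proof -
  interpret V: vector_space "\<lambda>c h. mconst c * h :: ('v, 'k) mpoly"
    by unfold_locales (simp_all add: mconst_simps algebra_simps)
  interpret U: comm_ring_hom "univariate i :: 'k poly \<Rightarrow> ('v, 'k) mpoly" by (rule univariate_hom)
  obtain B where B: "finite B" and spans: "\<And>h. \<exists>c. h - (\<Sum>b\<in>B. mconst (c b) * b) \<in> \<I>"
    using zero_dim by (auto simp: zero_dimensional_def)
  have "\<exists>b. b \<in> V.span B \<and> mvar i ^ k - b \<in> \<I>" for k
  proof -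
    obtain c where "mvar i ^ k - (\<Sum>b\<in>B. mconst (c b) * b) \<in> \<I>" using spans by blast
    moreover have "(\<Sum>b\<in>B. mconst (c b) * b) \<in> V.span B"
      by (intro V.span_sum V.span_scale V.span_base)
    ultimately show ?thesis by blast
  qed
  then obtain b where b: "\<And>k. b k \<in> V.span B" "\<And>k. mvar i ^ k - b k \<in> \<I>" by metis
  let ?N = "card B"
  show ?thesis
  \<comment> \<open>Linear dependence speaks of sets of vectors, so two powers sharing a
    representative form a separate case; there the difference of the two powers lies in the
    ideal.\<close>
  proof (cases "inj_on b {..?N}")
    case False
    then obtain k l where kl: "k \<noteq> l" "b k = b l" by (auto simp: inj_on_def)
    let ?p = "Polynomial.monom (1::'k) k - Polynomial.monom 1 l"
    have "coeff ?p k = 1" using kl by simp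
    then have "?p \<noteq> 0" by (metis coeff_0 zero_neq_one)
    moreover have "univariate i ?p = (mvar i ^ k - b k) - (mvar i ^ l - b l)"
      by (simp add: U.hom_minus univariate_monom mconst_simps kl)
    then have "univariate i ?p \<in> \<I>" using b(2) is_idealD(6)[OF ideal] by simp
    ultimately show ?thesis by blast
  next
    case True
    have "V.dependent (b ` {..?N})"
    proof (rule ccontr)
      assume "V.independent (b ` {..?N})"
      then have "card (b ` {..?N}) \<le> ?N" using V.independent_span_bound[OF B] b(1) by blast
      then show False using card_image[OF True] by simp
    qed
    then obtain u where u: "(\<Sum>v\<in>b ` {..?N}. mconst (u v) * v) = 0" "\<exists>v\<in>b ` {..?N}. u v \<noteq> 0"
      using V.dependent_finite[of "b ` {..?N}"] by auto
    let ?p = "\<Sum>k\<le>?N. Polynomial.monom (u (b k)) k"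
    obtain k where k: "k \<le> ?N" "u (b k) \<noteq> 0" using u(2) by auto
    then have "coeff ?p k \<noteq> 0" by (simp add: coeff_sum if_distrib cong: if_cong)
    then have "?p \<noteq> 0" by (metis coeff_0)
    moreover have "univariate i ?p = (\<Sum>k\<le>?N. mconst (u (b k)) * (mvar i ^ k - b k)) + (\<Sum>k\<le>?N. mconst (u (b k)) * b k)"
      by (simp add: U.hom_sum univariate_monom algebra_simps flip: sum.distrib)
    moreover have "(\<Sum>k\<le>?N. mconst (u (b k)) * b k) = 0"
      using u(1) sum.reindex[OF True, of "\<lambda>v. mconst (u v) * v"] by (simp add: o_def)
    moreover have "(\<Sum>k\<le>?N. mconst (u (b k)) * (mvar i ^ k - b k)) \<in> \<I>"
      by (intro is_idealD(7)[OF ideal] is_idealD(3)[OF ideal] b)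
    ultimately have "?p \<noteq> 0 \<and> univariate i ?p \<in> \<I>" by simp
    then show ?thesis by blast
  qed
qed

text \<open>Nonzero constants qualify; they arise when the ideal contains 1.\<close>

definition simple_roots :: "'a::field poly \<Rightarrow> bool" where
  "simple_roots p \<longleftrightarrow> p \<noteq> 0 \<and> (\<forall>a. poly p a = 0 \<longrightarrow> poly (pderiv p) a \<noteq> 0)"

lemma map_poly_to_ac_mult: "map_poly to_ac (p * q) = map_poly to_ac p * map_poly to_ac q"
  by (intro poly_eqI) (simp add: coeff_map_poly coeff_mult to_ac_sum)

lemma coeffs_in_range_to_acE:
  assumes "coeffs_in (range to_ac) p"
  obtains p0 where "p = map_poly to_ac p0"
proof (rule that)
  show "p = map_poly to_ac (map_poly of_ac p)"
    using assms by (intro poly_eqI) (simp add: coeff_map_poly coeffs_in_def to_ac_of_ac)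
qed

lemma map_poly_to_ac_eq_iff: "map_poly to_ac p = map_poly to_ac q \<longleftrightarrow> p = q"
  by (auto simp: poly_eq_iff coeff_map_poly)

lemma degree_map_poly_to_ac: "Polynomial.degree (map_poly to_ac p) = Polynomial.degree p"
  by (rule degree_map_poly) simp

text \<open>A polynomial of least degree has simple roots: a multiple root would give a factor \<open>\<mu>\<^sup>2\<close>, and
  dropping one \<open>\<mu>\<close> stays in the radical ideal.\<close>

lemma exists_simple_univariate_in_ideal:
  fixes \<I> :: "('v::finite, 'k::field) mpoly set"
  assumes ideal: "is_ideal \<I>" and zero_dim: "zero_dimensional \<I>" and radical: "radical_ideal \<I>"
    and char: "CHAR('k) = 0"
  shows "\<exists>p. univariate i p \<in> \<I> \<and> simple_roots (map_poly to_ac p)"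
proof -
  let ?K = "range to_ac :: 'k alg_closure set"
  note K = subfield_range_to_ac
  have char': "CHAR('k alg_closure) = 0" using char by simp
  let ?P = "\<lambda>p. p \<noteq> 0 \<and> univariate i p \<in> \<I>"
  obtain p0 where "?P p0" using exists_univariate_in_ideal[OF ideal zero_dim] by blast
  then obtain p where p: "?P p" and min: "\<And>q. ?P q \<Longrightarrow> Polynomial.degree p \<le> Polynomial.degree q"
    using ex_has_least_nat[of ?P p0 Polynomial.degree] by auto
  let ?p = "map_poly to_ac p"
  have p0: "?p \<noteq> 0" using p map_poly_to_ac_eq_iff[of p 0] by simp
  have "poly (pderiv ?p) a \<noteq> 0" if a: "poly ?p a = 0" for a
  proof
    assume d: "poly (pderiv ?p) a = 0"
    obtain \<mu> where \<mu>: "minimal_poly ?K a \<mu>"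
      using minimal_poly_exists[OF K] algebraic_over_range_to_ac by blast
    obtain h where h: "coeffs_in ?K h" "?p = \<mu> * h"
      by (rule minimal_poly_dvd[OF K \<mu> coeffs_in_range_to_ac_map a])
    have "poly (pderiv \<mu>) a * poly h a = 0"
      using d \<mu> by (auto simp: h(2) pderiv_mult minimal_poly_def)
    then have "poly h a = 0" using minimal_poly_separable[OF K \<mu> char'] by auto
    then obtain r where r: "coeffs_in ?K r" "h = \<mu> * r" by (rule minimal_poly_dvd[OF K \<mu> h(1)])
    \<comment> \<open>Division over \<open>range to_ac\<close> ensures that the factors come from
      polynomials over \<open>'k\<close>, where the ideal lives.\<close>
    obtain h0 where h0: "h = map_poly to_ac h0" by (rule coeffs_in_range_to_acE[OF h(1)])
    obtain r0 where r0: "r = map_poly to_ac r0" by (rule coeffs_in_range_to_acE[OF r(1)])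
    \<comment> \<open>From \<open>p = \<mu> h\<close> and \<open>h = \<mu> r\<close>, the square of
      \<open>h\<close> is a multiple of \<open>p\<close>; radicality then puts \<open>h\<close>, of
      smaller degree, into the ideal.\<close>
    have "h * h = ?p * r" by (simp add: h(2) r(2))
    then have "h0 * h0 = p * r0"
      by (simp add: h0 r0 map_poly_to_ac_eq_iff flip: map_poly_to_ac_mult)
    then have "univariate i h0 * univariate i h0 = univariate i p * univariate i r0"
      by (simp flip: univariate_mult)
    then have "univariate i h0 ^ 2 \<in> \<I>" using p is_idealD(4)[OF ideal] by (simp add: power2_eq_square)
    then have "univariate i h0 \<in> \<I>" using radical by (auto simp: radical_ideal_def)
    moreover have "h0 \<noteq> 0" using h0 h(2) p0 by auto
    ultimately have "Polynomial.degree p \<le> Polynomial.degree h0" using min by blast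
    moreover have "Polynomial.degree p = Polynomial.degree \<mu> + Polynomial.degree h0"
      using h(2) h0 p0 degree_mult_eq[of \<mu> h] degree_map_poly_to_ac[of p] degree_map_poly_to_ac[of h0]
      by auto
    ultimately show False using minimal_poly_degree_pos[OF \<mu>] by simp
  qed
  then show ?thesis using p p0 by (auto simp: simple_roots_def)
qed

section \<open>Linear functionals vanishing on the ideal\<close>

text \<open>An element of the dual of the quotient algebra, with scalars extended to the algebraic
  closure.\<close>

definition functional :: "('v::finite, 'k::field) mpoly set \<Rightarrow> (('v, 'k) mpoly \<Rightarrow> 'k alg_closure) \<Rightarrow> bool" where
  "functional \<I> \<phi> \<longleftrightarrow> (\<forall>h k. \<phi> (h + k) = \<phi> h + \<phi> k) \<and> (\<forall>c h. \<phi> (mconst c * h) = to_ac c * \<phi> h) \<and>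
     (\<forall>h\<in>\<I>. \<phi> h = 0)"

definition point_combination :: "('v::finite, 'k::field) mpoly set \<Rightarrow> (('v, 'k) mpoly \<Rightarrow> 'k alg_closure) \<Rightarrow> bool" where
  "point_combination \<I> \<phi> \<longleftrightarrow> (\<exists>c. \<forall>h. \<phi> h = (\<Sum>\<xi>\<in>zero_set \<I>. c \<xi> * mpeval to_ac \<xi> h))"

definition eigenfunctional :: "'v set \<Rightarrow> ('v \<Rightarrow> 'k alg_closure) \<Rightarrow> (('v, 'k::field) mpoly \<Rightarrow> 'k alg_closure) \<Rightarrow> bool" where
  "eigenfunctional S \<xi> \<phi> \<longleftrightarrow> (\<forall>i\<in>S. \<forall>h. \<phi> (mvar i * h) = \<xi> i * \<phi> h)"

text \<open>\<open>P\<close> evaluated at the transpose of multiplication by \<open>mvar i\<close>.\<close>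

definition poly_act :: "'v \<Rightarrow> 'k alg_closure poly \<Rightarrow> (('v, 'k::field) mpoly \<Rightarrow> 'k alg_closure) \<Rightarrow> ('v, 'k) mpoly \<Rightarrow> 'k alg_closure" where
  "poly_act i P \<phi> h = (\<Sum>k\<le>Polynomial.degree P. coeff P k * \<phi> (mvar i ^ k * h))"

lemma poly_act_superset:
  "Polynomial.degree P \<le> N \<Longrightarrow> poly_act i P \<phi> h = (\<Sum>k\<le>N. coeff P k * \<phi> (mvar i ^ k * h))"
  unfolding poly_act_def by (rule sum.mono_neutral_left) (auto simp: coeff_eq_0)

lemma poly_act_add: "poly_act i (P + Q) \<phi> h = poly_act i P \<phi> h + poly_act i Q \<phi> h"
proof -
  let ?N = "max (Polynomial.degree P) (Polynomial.degree Q)"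
  have "Polynomial.degree (P + Q) \<le> ?N" by (rule degree_add_le_max)
  then show ?thesis
    by (simp add: poly_act_superset[of _ ?N] algebra_simps sum.distrib)
qed

lemma poly_act_smult: "poly_act i (smult c P) \<phi> h = c * poly_act i P \<phi> h"
  by (simp add: poly_act_superset[of _ "Polynomial.degree P"] sum_distrib_left mult.assoc)

lemma poly_act_pCons: "poly_act i (pCons a P) \<phi> h = a * \<phi> h + poly_act i P \<phi> (mvar i * h)"
  by (subst poly_act_superset[OF degree_pCons_le])
    (simp add: sum.atMost_Suc_shift poly_act_def mult_ac del: sum.atMost_Suc)

lemma poly_act_0 [simp]: "poly_act i 0 \<phi> h = 0"
  by (simp add: poly_act_def)

text \<open>When \<open>univariate i p\<close> lies in the ideal, the right-hand side vanishes, so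
  \<open>p\<close> annihilates the transposed multiplication by \<open>mvar i\<close> on every
  functional.\<close>

lemma functional_univariate:
  assumes "functional \<I> \<phi>"
  shows "poly_act i (map_poly to_ac p) \<phi> h = \<phi> (univariate i p * h)"
proof (induction p arbitrary: h)
  case 0
  have "\<phi> (0 + 0) = \<phi> 0 + \<phi> 0" using assms unfolding functional_def by blast
  then have "\<phi> 0 = 0" by (metis add_0 add_right_cancel)
  then show ?case by (simp add: univariate_simps)
next
  case (pCons a p)
  have "univariate i (pCons a p) * h = mconst a * h + univariate i p * (mvar i * h)"
    by (simp add: univariate_simps algebra_simps)
  with pCons assms show ?case by (simp add: map_poly_pCons poly_act_pCons functional_def)
qed

lemma functionalD:
  assumes "functional \<I> \<phi>"
  shows "\<phi> (h + k) = \<phi> h + \<phi> k" "\<phi> (mconst c * h) = to_ac c * \<phi> h" "h \<in> \<I> \<Longrightarrow> \<phi> h = 0"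
  using assms by (auto simp: functional_def)

lemma functional_poly_act:
  assumes \<phi>: "functional \<I> \<phi>" and ideal: "is_ideal \<I>"
  shows "functional \<I> (poly_act i P \<phi>)"
  unfolding functional_def
proof (intro conjI allI ballI)
  show "poly_act i P \<phi> (h + k) = poly_act i P \<phi> h + poly_act i P \<phi> k" for h k
    by (simp add: poly_act_def distrib_left functionalD(1)[OF \<phi>] sum.distrib)
  show "poly_act i P \<phi> (mconst c * h) = to_ac c * poly_act i P \<phi> h" for c h
    unfolding poly_act_def sum_distrib_left
    by (rule sum.cong) (simp_all only: mult.left_commute[of _ "mconst c"] functionalD(2)[OF \<phi>] mult.left_commute[of "to_ac c"])
  show "poly_act i P \<phi> h = 0" if "h \<in> \<I>" for h
    by (simp add: poly_act_def functionalD(3)[OF \<phi>] is_idealD(3)[OF ideal that])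
qed

lemma functional_combination:
  assumes "functional \<I> \<phi>" "functional \<I> \<psi>"
  shows "functional \<I> (\<lambda>h. \<phi> h - c * \<psi> h)"
  using assms unfolding functional_def by (simp add: algebra_simps)

lemma eigenfunctional_poly_act:
  assumes "eigenfunctional S \<xi> \<phi>"
  shows "eigenfunctional S \<xi> (poly_act i P \<phi>)"
  unfolding eigenfunctional_def
proof (intro ballI allI)
  fix j h assume "j \<in> S"
  then have "\<phi> (mvar i ^ k * (mvar j * h)) = \<xi> j * \<phi> (mvar i ^ k * h)" for k
    using assms by (simp only: eigenfunctional_def mult.left_commute[of _ "mvar j"])
  then show "poly_act i P \<phi> (mvar j * h) = \<xi> j * poly_act i P \<phi> h"
    unfolding poly_act_def sum_distrib_left by (intro sum.cong) (simp_all only: mult.left_commute)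
qed

lemma poly_act_eigen:
  assumes "\<And>h. \<phi> (mvar i * h) = b * \<phi> h"
  shows "poly_act i P \<phi> h = poly P b * \<phi> h"
proof -
  have "\<phi> (mvar i ^ k * h) = b ^ k * \<phi> h" for k
    by (induction k) (simp_all add: assms mult.assoc)
  then show ?thesis by (simp add: poly_act_def poly_altdef sum_distrib_right mult.assoc)
qed

lemma poly_act_linear: "poly_act i P (\<lambda>h. \<phi> h - c * \<psi> h) h = poly_act i P \<phi> h - c * poly_act i P \<psi> h"
  by (simp add: poly_act_def right_diff_distrib sum_subtractf sum_distrib_left mult.left_commute)

lemma point_combination_add:
  assumes "point_combination \<I> \<phi>" "point_combination \<I> \<psi>" "\<And>h. \<theta> h = \<phi> h + c * \<psi> h"
  shows "point_combination \<I> \<theta>"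
proof -
  obtain a where a: "\<And>h. \<phi> h = (\<Sum>\<xi>\<in>zero_set \<I>. a \<xi> * mpeval to_ac \<xi> h)"
    using assms(1) unfolding point_combination_def by blast
  obtain b where b: "\<And>h. \<psi> h = (\<Sum>\<xi>\<in>zero_set \<I>. b \<xi> * mpeval to_ac \<xi> h)"
    using assms(2) unfolding point_combination_def by blast
  have \<theta>: "\<theta> h = (\<Sum>\<xi>\<in>zero_set \<I>. (a \<xi> + c * b \<xi>) * mpeval to_ac \<xi> h)" for h
    by (simp add: assms(3) a b distrib_right sum.distrib sum_distrib_left mult.assoc)
  show ?thesis unfolding point_combination_def by (rule exI, rule allI, rule \<theta>)
qed

lemma point_combination_0: "(\<And>h. \<phi> h = 0) \<Longrightarrow> point_combination \<I> \<phi>"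
  unfolding point_combination_def by (intro exI[of _ "\<lambda>_. 0"]) simp

text \<open>One root \<open>b\<close> of \<open>P = (x - b) Q\<close> is split off at a time.
  Letting \<open>Q\<close> act on \<open>\<phi>\<close> gives an eigenfunctional \<open>v\<close>
  for \<open>b\<close>, which \<open>step\<close> covers, and \<open>\<phi> - v/Q(b)\<close> is
  annihilated by \<open>Q\<close>, of smaller degree. That \<open>b\<close> is a simple root means
  \<open>Q(b) \<noteq> 0\<close>.\<close>

lemma point_combination_eigen_step:
  assumes ideal: "is_ideal \<I>"
    and step: "\<And>\<phi> \<xi>. functional \<I> \<phi> \<Longrightarrow> eigenfunctional (insert i S) \<xi> \<phi> \<Longrightarrow> point_combination \<I> \<phi>"
    and i: "i \<notin> S"
    and "simple_roots P" "functional \<I> \<phi>" "eigenfunctional S \<xi> \<phi>" "\<And>h. poly_act i P \<phi> h = 0"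
  shows "point_combination \<I> \<phi>"
  using assms(4-7)
proof (induction "Polynomial.degree P" arbitrary: P \<phi> rule: less_induct)
  case less
  show ?case
  proof (cases "Polynomial.degree P = 0")
    case True
    then obtain c where c: "P = [:c:]" by (rule degree_eq_zeroE)
    then have "c \<noteq> 0" using less.prems by (simp add: simple_roots_def)
    then have "\<phi> h = 0" for h using less.prems(4)[of h] by (simp add: c poly_act_pCons)
    then show ?thesis by (rule point_combination_0)
  next
    case False
    then obtain b where b: "poly P b = 0" using alg_closed_imp_poly_has_root by blast
    then obtain Q where Q: "P = [:- b, 1:] * Q" by (metis dvdE poly_eq_0_iff_dvd)
    then have Q': "P = pCons 0 Q + smult (- b) Q" by (simp add: algebra_simps)
    have "Q \<noteq> 0" using less.prems(1) by (auto simp: Q simple_roots_def)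
    \<comment> \<open>At \<open>b\<close> this gives \<open>Q(b) = P'(b)\<close>; at a root
      \<open>a\<close> of \<open>Q\<close> it gives \<open>P'(a) = (a - b) Q'(a)\<close>, so
      \<open>Q\<close> inherits simple roots.\<close>
    have pderiv: "pderiv P = Q + [:- b, 1:] * pderiv Q" 
      unfolding Q pderiv_mult by (simp add: pderiv_pCons)
    have "poly (pderiv P) b = poly Q b" by (simp add: pderiv)
    then have c: "poly Q b \<noteq> 0" using b less.prems(1) by (auto simp: simple_roots_def)
    have "simple_roots Q" unfolding simple_roots_def
    proof (intro conjI allI impI)
      fix a assume a: "poly Q a = 0"
      then have "poly P a = 0" by (simp add: Q)
      then have "poly (pderiv P) a \<noteq> 0" using less.prems(1) unfolding simple_roots_def by blast
      then show "poly (pderiv Q) a \<noteq> 0" using a by (simp add: pderiv)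
    qed fact
    define v where "v = poly_act i Q \<phi>"
    have v_eigen: "v (mvar i * h) = b * v h" for h
      using less.prems(4)[of h] unfolding Q' poly_act_add poly_act_smult poly_act_pCons by (simp add: v_def)
    have v: "functional \<I> v" "eigenfunctional S \<xi> v"
      unfolding v_def by (rule functional_poly_act[OF less.prems(2) ideal] eigenfunctional_poly_act[OF less.prems(3)])+
    have "eigenfunctional (insert i S) (\<xi>(i := b)) v"
      using v(2) v_eigen i by (auto simp: eigenfunctional_def)
    with v(1) have v_comb: "point_combination \<I> v" by (rule step)
    define \<psi> where "\<psi> h = \<phi> h - inverse (poly Q b) * v h" for h
    have "point_combination \<I> \<psi>"
    proof (rule less.hyps[of Q])
      show "Polynomial.degree Q < Polynomial.degree P"
        unfolding Q by (subst degree_mult_eq) (use \<open>Q \<noteq> 0\<close> in auto)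
      show "functional \<I> \<psi>" unfolding \<psi>_def by (rule functional_combination) (fact less.prems v)+
      show "eigenfunctional S \<xi> \<psi>" using less.prems(3) v(2)
        by (simp add: eigenfunctional_def \<psi>_def algebra_simps)
      show "poly_act i Q \<psi> h = 0" for h
        unfolding \<psi>_def poly_act_linear poly_act_eigen[where \<phi> = v, OF v_eigen] using c by (simp add: v_def)
    qed fact
    then show ?thesis using v_comb
      by (rule point_combination_add[where c = "inverse (poly Q b)"]) (simp add: \<psi>_def)
  qed
qed

theorem functional_point_combination:
  fixes \<I> :: "('v::finite, 'k::field) mpoly set"
  assumes ideal: "is_ideal \<I>" and zero_dim: "zero_dimensional \<I>" and radical: "radical_ideal \<I>"
    and char: "CHAR('k) = 0" and fin: "finite (zero_set \<I>)" and \<phi>: "functional \<I> \<phi>"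
  shows "point_combination \<I> \<phi>"
proof -
  \<comment> \<open>\<open>S\<close> collects the variables whose multiplication already acts by a
    scalar; the induction shrinks its complement.\<close>
  have "point_combination \<I> \<phi>" if "functional \<I> \<phi>" "eigenfunctional S \<xi> \<phi>" for S \<xi> \<phi>
    using that
  proof (induction "card (- S)" arbitrary: S \<xi> \<phi> rule: less_induct)
    case less
    show ?case
    proof (cases "S = UNIV")
      case False
      then obtain i where i: "i \<notin> S" by blast
      obtain p where p: "univariate i p \<in> \<I>" "simple_roots (map_poly to_ac p)"
        using exists_simple_univariate_in_ideal[OF ideal zero_dim radical char] by blast
      show ?thesis
      proof (rule point_combination_eigen_step[OF ideal _ i p(2) less.prems])
        fix \<phi> \<xi> assume "functional \<I> \<phi>" "eigenfunctional (insert i S) \<xi> \<phi>"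
        moreover have "card (- insert i S) < card (- S)"
          using i by (intro psubset_card_mono) auto
        ultimately show "point_combination \<I> \<phi>" using less.hyps by blast
      next
        show "poly_act i (map_poly to_ac p) \<phi> h = 0" for h
          using less.prems(1) is_idealD(4)[OF ideal p(1)]
          by (simp add: functional_univariate[OF less.prems(1)] functional_def)
      qed
    next
      case True
      interpret to_ac: comm_ring_hom to_ac by (rule to_ac_hom)
      note \<phi> = functionalD[OF less.prems(1)]
      have eigen: "\<phi> (mvar i * g) = \<xi> i * \<phi> g" for i g
        using less.prems(2) unfolding True eigenfunctional_def by blast
      have "\<phi> (h * g) = mpeval to_ac \<xi> h * \<phi> g" for h g
      proof (induction h arbitrary: g rule: mpoly_induct)
        case (add p q)
        then show ?case by (simp add: distrib_right \<phi>(1) to_ac.mpeval_add)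
      next
        case (mult p q)
        then show ?case by (simp add: mult.assoc to_ac.mpeval_mult)
      qed (simp_all add: \<phi>(2) eigen mpeval_mconst to_ac.mpeval_mvar)
      from this[of _ 1] have ev: "\<phi> h = mpeval to_ac \<xi> h * \<phi> 1" for h unfolding mult_1_right .
      show ?thesis
      proof (cases "\<phi> 1 = 0")
        case True
        then have "\<phi> h = 0" for h using ev[of h] by simp
        then show ?thesis by (rule point_combination_0)
      next
        case False
        \<comment> \<open>Since \<open>\<phi>\<close> vanishes on the ideal and
          \<open>\<phi> 1 \<noteq> 0\<close>, the tuple of eigenvalues is a point of the zero
          set.\<close>
        have "mpeval to_ac \<xi> h = 0" if "h \<in> \<I>" for h
          using \<phi>(3)[OF that] ev[of h] False by simp
        then have "\<xi> \<in> zero_set \<I>" unfolding zero_set_def by blast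
        have "\<phi> h = (\<Sum>\<eta>\<in>zero_set \<I>. (if \<eta> = \<xi> then \<phi> 1 else 0) * mpeval to_ac \<eta> h)" for h
        proof -
          have "(\<Sum>\<eta>\<in>zero_set \<I>. (if \<eta> = \<xi> then \<phi> 1 else 0) * mpeval to_ac \<eta> h) =
              (\<Sum>\<eta>\<in>zero_set \<I>. if \<eta> = \<xi> then \<phi> 1 * mpeval to_ac \<xi> h else 0)"
            by (intro sum.cong) auto
          also have "\<dots> = \<phi> h" using fin \<open>\<xi> \<in> zero_set \<I>\<close> by (simp add: ev[of h] mult.commute)
          finally show ?thesis by simp
        qed
        note expansion = this
        show ?thesis unfolding point_combination_def by (rule exI, rule allI, rule expansion)
      qed
    qed
  qed
  from this[OF \<phi>, of "{}"] show ?thesis by (simp add: eigenfunctional_def)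
qed

text \<open>Taking the relation at \<open>x_i h\<close> and subtracting \<open>\<eta>_i\<close>
  times the relation at \<open>h\<close> removes the point \<open>\<eta>\<close> and multiplies the
  coefficient at \<open>\<zeta>\<close> by \<open>\<zeta>_i - \<eta>_i\<close>. For each
  \<open>\<zeta>\<close> a coordinate \<open>i\<close> is chosen that makes this factor
  nonzero.\<close>

lemma point_evaluations_independent:
  fixes Z :: "('v::finite \<Rightarrow> 'k::field alg_closure) set"
  assumes "finite Z" "\<And>h. (\<Sum>\<xi>\<in>Z. c \<xi> * mpeval to_ac \<xi> h) = 0" "\<xi> \<in> Z"
  shows "c \<xi> = 0"
  using assms
proof (induction Z arbitrary: c \<xi> rule: finite_induct)
  case (insert \<eta> Z)
  interpret to_ac: comm_ring_hom to_ac by (rule to_ac_hom)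
  have zero: "c \<zeta> = 0" if \<zeta>: "\<zeta> \<in> Z" for \<zeta>
  proof -
    have "\<zeta> \<noteq> \<eta>" using \<zeta> insert.hyps by blast
    then obtain i where i: "\<zeta> i \<noteq> \<eta> i" by blast
    have "c \<zeta> * (\<zeta> i - \<eta> i) = 0"
    proof (rule insert.IH[OF _ \<zeta>])
      fix h
      have "(\<Sum>\<xi>\<in>Z. c \<xi> * (\<xi> i - \<eta> i) * mpeval to_ac \<xi> h) = (\<Sum>\<xi>\<in>insert \<eta> Z. c \<xi> * (\<xi> i - \<eta> i) * mpeval to_ac \<xi> h)"
        using insert.hyps by simp
      also have "\<dots> = (\<Sum>\<xi>\<in>insert \<eta> Z. c \<xi> * mpeval to_ac \<xi> (mvar i * h)) - \<eta> i * (\<Sum>\<xi>\<in>insert \<eta> Z. c \<xi> * mpeval to_ac \<xi> h)"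
        unfolding sum_distrib_left sum_subtractf[symmetric]
        by (rule sum.cong) (simp_all add: to_ac.mpeval_mult to_ac.mpeval_mvar algebra_simps)
      also have "\<dots> = 0" using insert.prems(1) by (simp del: sum.insert)
      finally show "(\<Sum>\<xi>\<in>Z. c \<xi> * (\<xi> i - \<eta> i) * mpeval to_ac \<xi> h) = 0" .
    qed
    then show ?thesis using i by simp
  qed
  have "c \<eta> = 0"
    using insert.prems(1)[of "mconst 1"] insert.hyps zero by (simp add: mpeval_mconst)
  then show ?case using zero insert.prems(2) by blast
qed simp

section \<open>Companion matrices and the trace formula\<close>

locale companion = groebner mle \<I> G
  for mle :: "'v::{finite,linorder} monom \<Rightarrow> 'v monom \<Rightarrow> bool" and \<I> G :: "('v, 'k::field) mpoly set" +
  fixes es :: "'v monom list"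
  assumes zero_dim: "zero_dimensional \<I>" and radical: "radical_ideal \<I>"
    and char: "CHAR('k) = 0" and fin: "finite (zero_set \<I>)"
    and es: "distinct es" "set es = standard_monoms mle G"
begin

abbreviation d :: nat where "d \<equiv> length es"
abbreviation Z :: "('v \<Rightarrow> 'k alg_closure) set" where "Z \<equiv> zero_set \<I>"

section \<open>Duality between coordinates and evaluations\<close>

definition coord :: "nat \<Rightarrow> ('v, 'k) mpoly \<Rightarrow> 'k alg_closure" where
  "coord \<beta> h = to_ac (Poly_Mapping.lookup (normal_form mle G h) (es ! \<beta>))"

definition basis_value :: "nat \<Rightarrow> ('v \<Rightarrow> 'k alg_closure) \<Rightarrow> 'k alg_closure" where
  "basis_value \<alpha> \<xi> = mpeval to_ac \<xi> (Poly_Mapping.single (es ! \<alpha>) 1)"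

text \<open>The interpolation weights: \<open>weight \<beta>\<close> expresses the coordinate functional \<open>coord \<beta>\<close> through the
  evaluations at the points of \<open>Z\<close>.\<close>

definition weight :: "nat \<Rightarrow> ('v \<Rightarrow> 'k alg_closure) \<Rightarrow> 'k alg_closure" where
  "weight \<beta> = (SOME c. \<forall>h. coord \<beta> h = (\<Sum>\<xi>\<in>Z. c \<xi> * mpeval to_ac \<xi> h))"

lemma coord_eq_sum: "coord \<beta> h = (\<Sum>\<xi>\<in>Z. weight \<beta> \<xi> * mpeval to_ac \<xi> h)"
proof -
  have "functional \<I> (coord \<beta>)"
    unfolding functional_def coord_def
    by (simp add: normal_form_add normal_form_scale normal_form_ideal lookup_add lookup_mconst_times)
  then have "point_combination \<I> (coord \<beta>)"
    by (rule functional_point_combination[OF ideal zero_dim radical char fin])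
  then have "\<exists>c. \<forall>h. coord \<beta> h = (\<Sum>\<xi>\<in>Z. c \<xi> * mpeval to_ac \<xi> h)"
    by (simp only: point_combination_def)
  from someI_ex[OF this, folded weight_def] show ?thesis by blast
qed

lemma coord_basis:
  assumes "\<alpha> < d" "\<beta> < d"
  shows "coord \<beta> (Poly_Mapping.single (es ! \<alpha>) 1) = (if \<alpha> = \<beta> then 1 else 0)"
proof -
  have "es ! \<alpha> \<in> standard_monoms mle G" using assms es(2) nth_mem by blast
  then show ?thesis using assms nth_eq_iff_index_eq[OF es(1), of \<alpha> \<beta>]
    by (auto simp: coord_def normal_form_standard lookup_single when_def)
qed

text \<open>One side of the duality: \<open>coord \<beta>\<close> applied to
  \<open>e_\<alpha>\<close>. It recovers a coordinate vector from its products with the value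
  vectors.\<close>

lemma weight_basis_value:
  assumes "\<alpha> < d" "\<beta> < d"
  shows "(\<Sum>\<xi>\<in>Z. weight \<beta> \<xi> * basis_value \<alpha> \<xi>) = (if \<alpha> = \<beta> then 1 else 0)"
  unfolding basis_value_def coord_eq_sum[symmetric] by (rule coord_basis[OF assms])

text \<open>Passing to the normal form changes \<open>h\<close> by an element of the ideal, hence
  leaves its value at a zero unchanged.\<close>

lemma mpeval_eq_sum_coord:
  assumes "\<xi> \<in> Z"
  shows "mpeval to_ac \<xi> h = (\<Sum>\<beta><d. coord \<beta> h * basis_value \<beta> \<xi>)"
proof -
  interpret to_ac: comm_ring_hom to_ac by (rule to_ac_hom)
  interpret ev: comm_ring_hom "mpeval to_ac \<xi>" by (rule to_ac.mpeval_hom)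
  let ?r = "normal_form mle G h"
  have "mpeval to_ac \<xi> (h - ?r) = 0" using normal_form_diff_in_ideal assms unfolding zero_set_def by blast
  then have "mpeval to_ac \<xi> h = mpeval to_ac \<xi> ?r" by (simp add: ev.hom_minus)
  also have "\<dots> = (\<Sum>t\<in>set es. to_ac (Poly_Mapping.lookup ?r t) * (\<Prod>v\<in>UNIV. \<xi> v ^ Poly_Mapping.lookup t v))"
    by (rule mpeval_superset) (simp, simp, simp add: es keys_normal_form)
  also have "\<dots> = (\<Sum>\<beta><d. coord \<beta> h * basis_value \<beta> \<xi>)"
    unfolding sum.reindex_bij_betw[OF bij_betw_nth[OF es(1) refl refl], symmetric]
    by (simp add: coord_def basis_value_def mpeval_single)
  finally show ?thesis .
qed

text \<open>The other side of the duality, on the diagonal. Evaluation at \<open>\<eta>\<close> is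
  expanded in the standard basis and the coordinates again through evaluations; independence of the
  evaluations compares the coefficients at \<open>\<eta>\<close>.\<close>

lemma weight_normalised:
  assumes \<eta>: "\<eta> \<in> Z"
  shows "(\<Sum>\<beta><d. weight \<beta> \<eta> * basis_value \<beta> \<eta>) = 1"
proof -
  \<comment> \<open>The condition \<open>\<eta> = \<eta>\<close> is kept so that the claim is
    literally the coefficient function at \<open>\<eta>\<close>.\<close>
  have "(\<Sum>\<beta><d. weight \<beta> \<eta> * basis_value \<beta> \<eta>) - (if \<eta> = \<eta> then 1 else 0) = 0"
  proof (rule point_evaluations_independent[OF fin _ \<eta>, where c = "\<lambda>\<xi>. (\<Sum>\<beta><d. weight \<beta> \<xi> * basis_value \<beta> \<eta>) - (if \<xi> = \<eta> then 1 else 0)"])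
    fix h
    have "mpeval to_ac \<eta> h = (\<Sum>\<beta><d. \<Sum>\<xi>\<in>Z. weight \<beta> \<xi> * mpeval to_ac \<xi> h * basis_value \<beta> \<eta>)"
      unfolding mpeval_eq_sum_coord[OF \<eta>] coord_eq_sum sum_distrib_right ..
    also have "\<dots> = (\<Sum>\<xi>\<in>Z. \<Sum>\<beta><d. weight \<beta> \<xi> * mpeval to_ac \<xi> h * basis_value \<beta> \<eta>)" by (rule sum.swap)
    also have "\<dots> = (\<Sum>\<xi>\<in>Z. (\<Sum>\<beta><d. weight \<beta> \<xi> * basis_value \<beta> \<eta>) * mpeval to_ac \<xi> h)"
      unfolding sum_distrib_right by (intro sum.cong refl) (simp add: mult_ac)
    finally have 1: "mpeval to_ac \<eta> h = (\<Sum>\<xi>\<in>Z. (\<Sum>\<beta><d. weight \<beta> \<xi> * basis_value \<beta> \<eta>) * mpeval to_ac \<xi> h)" .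
    have "(\<Sum>\<xi>\<in>Z. (if \<xi> = \<eta> then 1 else 0) * mpeval to_ac \<xi> h) = (\<Sum>\<xi>\<in>Z. if \<xi> = \<eta> then mpeval to_ac \<eta> h else 0)"
      by (rule sum.cong) auto
    also have "\<dots> = mpeval to_ac \<eta> h" using fin \<eta> by simp
    finally have 2: "(\<Sum>\<xi>\<in>Z. (if \<xi> = \<eta> then 1 else 0) * mpeval to_ac \<xi> h) = mpeval to_ac \<eta> h" .
    show "(\<Sum>\<xi>\<in>Z. ((\<Sum>\<beta><d. weight \<beta> \<xi> * basis_value \<beta> \<eta>) - (if \<xi> = \<eta> then 1 else 0)) * mpeval to_ac \<xi> h) = 0"
      unfolding left_diff_distrib sum_subtractf 2 1[symmetric] by simp
  qed
  then show ?thesis by simp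
qed

text \<open>\<open>M\<close> has the eigenvalue \<open>\<nu>\<close> on the vector of the values of the standard monomials at \<open>\<xi>\<close>.\<close>

definition eigen_mat :: "'k mat \<Rightarrow> ('v \<Rightarrow> 'k alg_closure) \<Rightarrow> 'k alg_closure \<Rightarrow> bool" where
  "eigen_mat M \<xi> \<nu> \<longleftrightarrow> M \<in> carrier_mat d d \<and>
     (\<forall>\<alpha><d. (\<Sum>\<beta><d. to_ac (M $$ (\<alpha>, \<beta>)) * basis_value \<beta> \<xi>) = \<nu> * basis_value \<alpha> \<xi>)"

lemma eigen_mat_one: "eigen_mat (1\<^sub>m d) \<xi> 1"
  unfolding eigen_mat_def
proof (intro conjI allI impI)
  fix \<alpha> assume \<alpha>: "\<alpha> < d"
  have "(\<Sum>\<beta><d. to_ac (1\<^sub>m d $$ (\<alpha>, \<beta>)) * basis_value \<beta> \<xi>) = (\<Sum>\<beta><d. if \<beta> = \<alpha> then basis_value \<alpha> \<xi> else 0)"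
    using \<alpha> by (intro sum.cong) auto
  then show "(\<Sum>\<beta><d. to_ac (1\<^sub>m d $$ (\<alpha>, \<beta>)) * basis_value \<beta> \<xi>) = 1 * basis_value \<alpha> \<xi>" using \<alpha> by simp
qed simp

lemma index_mult_mat_sum:
  "A \<in> carrier_mat d d \<Longrightarrow> B \<in> carrier_mat d d \<Longrightarrow> i < d \<Longrightarrow> j < d \<Longrightarrow>
    (A * B) $$ (i, j) = (\<Sum>k<d. A $$ (i, k) * B $$ (k, j))"
  by (auto simp: scalar_prod_def lessThan_atLeast0)

lemma eigen_mat_mult:
  assumes M: "eigen_mat M \<xi> \<nu>" and N: "eigen_mat N \<xi> \<mu>"
  shows "eigen_mat (M * N) \<xi> (\<nu> * \<mu>)"
  unfolding eigen_mat_def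
proof (intro conjI allI impI)
  have c: "M \<in> carrier_mat d d" "N \<in> carrier_mat d d" using M N by (simp_all add: eigen_mat_def)
  then show "M * N \<in> carrier_mat d d" by simp
  fix \<alpha> assume \<alpha>: "\<alpha> < d"
  have "(\<Sum>\<beta><d. to_ac ((M * N) $$ (\<alpha>, \<beta>)) * basis_value \<beta> \<xi>) =
      (\<Sum>\<beta><d. \<Sum>k<d. to_ac (M $$ (\<alpha>, k)) * to_ac (N $$ (k, \<beta>)) * basis_value \<beta> \<xi>)"
    by (rule sum.cong) (simp_all add: index_mult_mat_sum[OF c \<alpha>] to_ac_sum sum_distrib_right del: index_mult_mat)
  also have "\<dots> = (\<Sum>k<d. \<Sum>\<beta><d. to_ac (M $$ (\<alpha>, k)) * to_ac (N $$ (k, \<beta>)) * basis_value \<beta> \<xi>)" by (rule sum.swap)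
  also have "\<dots> = (\<Sum>k<d. to_ac (M $$ (\<alpha>, k)) * (\<mu> * basis_value k \<xi>))"
    using N by (intro sum.cong) (auto simp: eigen_mat_def mult.assoc simp flip: sum_distrib_left)
  also have "\<dots> = \<mu> * (\<Sum>k<d. to_ac (M $$ (\<alpha>, k)) * basis_value k \<xi>)"
    by (simp add: sum_distrib_left mult.left_commute)
  also have "\<dots> = \<nu> * \<mu> * basis_value \<alpha> \<xi>" using M \<alpha> by (simp add: eigen_mat_def)
  finally show "(\<Sum>\<beta><d. to_ac ((M * N) $$ (\<alpha>, \<beta>)) * basis_value \<beta> \<xi>) = \<nu> * \<mu> * basis_value \<alpha> \<xi>" .
qed

lemma eigen_mat_pow:
  assumes "eigen_mat M \<xi> \<nu>"
  shows "eigen_mat (M ^\<^sub>m k) \<xi> (\<nu> ^ k)"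
proof (induction k)
  \<comment> \<open>\<open>M ^\<^sub>m 0\<close> is the identity of size \<open>dim_row M\<close>,
    so the dimension of \<open>M\<close> has to be read off from the assumption.\<close>
  case 0
  then show ?case using assms eigen_mat_one[of \<xi>] by (auto simp: eigen_mat_def[of M])
next
  case (Suc k)
  from eigen_mat_mult[OF this assms] show ?case by (simp add: mult.commute)
qed

text \<open>Row \<open>\<alpha>\<close> holds the coordinates of \<open>x_i e_\<alpha>\<close>; its
  product with the value vector is the value of \<open>x_i e_\<alpha>\<close> at the zero
  \<open>\<xi>\<close>.\<close>

lemma eigen_companion_matrix:
  assumes \<xi>: "\<xi> \<in> Z"
  shows "eigen_mat (companion_matrix mle G es i) \<xi> (\<xi> i)"
  unfolding eigen_mat_def
proof (intro conjI allI impI)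
  interpret to_ac: comm_ring_hom to_ac by (rule to_ac_hom)
  fix \<alpha> assume \<alpha>: "\<alpha> < d"
  have "(\<Sum>\<beta><d. to_ac (companion_matrix mle G es i $$ (\<alpha>, \<beta>)) * basis_value \<beta> \<xi>) =
      (\<Sum>\<beta><d. coord \<beta> (mvar i * Poly_Mapping.single (es ! \<alpha>) 1) * basis_value \<beta> \<xi>)"
    using \<alpha> by (intro sum.cong) (simp_all add: companion_matrix_def coord_def)
  also have "\<dots> = \<xi> i * basis_value \<alpha> \<xi>"
    unfolding mpeval_eq_sum_coord[OF \<xi>, symmetric]
    by (simp add: to_ac.mpeval_mult to_ac.mpeval_mvar basis_value_def)
  finally show "(\<Sum>\<beta><d. to_ac (companion_matrix mle G es i $$ (\<alpha>, \<beta>)) * basis_value \<beta> \<xi>) = \<xi> i * basis_value \<alpha> \<xi>" .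
qed (simp add: companion_matrix_def)

lemma eigen_monom_at_mats:
  assumes T: "\<And>v. eigen_mat (T v) \<xi> (\<xi> v)"
  shows "eigen_mat (monom_at_mats d T t) \<xi> (\<Prod>v\<in>UNIV. \<xi> v ^ Poly_Mapping.lookup t v)"
proof -
  have "eigen_mat (foldr (\<lambda>v M. T v ^\<^sub>m Poly_Mapping.lookup t v * M) vs (1\<^sub>m d)) \<xi>
      (\<Prod>v\<leftarrow>vs. \<xi> v ^ Poly_Mapping.lookup t v)" for vs
    by (induction vs) (auto intro: eigen_mat_one eigen_mat_mult eigen_mat_pow T)
  from this[of "sorted_list_of_set UNIV"] show ?thesis
    by (simp add: monom_at_mats_def prod.distinct_set_conv_list[symmetric])
qed

lemma eigen_mpoly_at_mats:
  assumes T: "\<And>v. eigen_mat (T v) \<xi> (\<xi> v)"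
  shows "eigen_mat (mpoly_at_mats d T q) \<xi> (mpeval to_ac \<xi> q)"
  unfolding eigen_mat_def
proof (intro conjI allI impI)
  fix \<alpha> assume \<alpha>: "\<alpha> < d"
  have "(\<Sum>\<beta><d. to_ac (mpoly_at_mats d T q $$ (\<alpha>, \<beta>)) * basis_value \<beta> \<xi>) =
      (\<Sum>\<beta><d. \<Sum>t\<in>Poly_Mapping.keys q. to_ac (Poly_Mapping.lookup q t) * (to_ac (monom_at_mats d T t $$ (\<alpha>, \<beta>)) * basis_value \<beta> \<xi>))"
    using \<alpha> by (intro sum.cong) (simp_all add: mpoly_at_mats_def to_ac_sum sum_distrib_right mult.assoc)
  also have "\<dots> = (\<Sum>t\<in>Poly_Mapping.keys q. \<Sum>\<beta><d. to_ac (Poly_Mapping.lookup q t) * (to_ac (monom_at_mats d T t $$ (\<alpha>, \<beta>)) * basis_value \<beta> \<xi>))"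
    by (rule sum.swap)
  also have "\<dots> = (\<Sum>t\<in>Poly_Mapping.keys q. to_ac (Poly_Mapping.lookup q t) * ((\<Prod>v\<in>UNIV. \<xi> v ^ Poly_Mapping.lookup t v) * basis_value \<alpha> \<xi>))"
    using eigen_monom_at_mats[OF T] \<alpha> by (intro sum.cong) (simp_all add: eigen_mat_def flip: sum_distrib_left)
  also have "\<dots> = mpeval to_ac \<xi> q * basis_value \<alpha> \<xi>"
    by (simp add: mpeval_def sum_distrib_right mult.assoc)
  finally show "(\<Sum>\<beta><d. to_ac (mpoly_at_mats d T q $$ (\<alpha>, \<beta>)) * basis_value \<beta> \<xi>) = mpeval to_ac \<xi> q * basis_value \<alpha> \<xi>" .
qed (simp add: mpoly_at_mats_def)

section \<open>Trace and inverse from joint eigenvectors\<close>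

text \<open>Conjugation invariance of the trace, written out: the duality turns a diagonal entry of
  \<open>M\<close> into the action of \<open>M\<close> on the value vectors, and summing over
  \<open>\<alpha>\<close> leaves the weight sums, which are 1.\<close>

lemma trace_eq_sum_eigenvalues:
  assumes carrier: "M \<in> carrier_mat d d" and M: "\<And>\<xi>. \<xi> \<in> Z \<Longrightarrow> eigen_mat M \<xi> (\<nu> \<xi>)"
  shows "to_ac (mat_trace M) = (\<Sum>\<xi>\<in>Z. \<nu> \<xi>)"
proof -
  have "to_ac (M $$ (\<alpha>, \<alpha>)) = (\<Sum>\<xi>\<in>Z. \<nu> \<xi> * (weight \<alpha> \<xi> * basis_value \<alpha> \<xi>))" if \<alpha>: "\<alpha> < d" for \<alpha>
  proof -
    have "to_ac (M $$ (\<alpha>, \<alpha>)) = (\<Sum>\<beta><d. if \<beta> = \<alpha> then to_ac (M $$ (\<alpha>, \<alpha>)) else 0)" using \<alpha> by simp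
    also have "\<dots> = (\<Sum>\<beta><d. to_ac (M $$ (\<alpha>, \<beta>)) * (\<Sum>\<xi>\<in>Z. weight \<alpha> \<xi> * basis_value \<beta> \<xi>))"
      by (rule sum.cong) (auto simp: weight_basis_value[OF _ \<alpha>])
    also have "\<dots> = (\<Sum>\<beta><d. \<Sum>\<xi>\<in>Z. weight \<alpha> \<xi> * (to_ac (M $$ (\<alpha>, \<beta>)) * basis_value \<beta> \<xi>))"
      by (simp only: sum_distrib_left mult.left_commute)
    also have "\<dots> = (\<Sum>\<xi>\<in>Z. \<Sum>\<beta><d. weight \<alpha> \<xi> * (to_ac (M $$ (\<alpha>, \<beta>)) * basis_value \<beta> \<xi>))" by (rule sum.swap)
    also have "\<dots> = (\<Sum>\<xi>\<in>Z. weight \<alpha> \<xi> * (\<nu> \<xi> * basis_value \<alpha> \<xi>))"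
      using M \<alpha> by (intro sum.cong) (simp_all add: eigen_mat_def flip: sum_distrib_left)
    finally show ?thesis by (simp only: mult.left_commute)
  qed
  then have "to_ac (mat_trace M) = (\<Sum>\<alpha><d. \<Sum>\<xi>\<in>Z. \<nu> \<xi> * (weight \<alpha> \<xi> * basis_value \<alpha> \<xi>))"
    using carrier by (simp add: mat_trace_def to_ac_sum)
  also have "\<dots> = (\<Sum>\<xi>\<in>Z. \<Sum>\<alpha><d. \<nu> \<xi> * (weight \<alpha> \<xi> * basis_value \<alpha> \<xi>))" by (rule sum.swap)
  also have "\<dots> = (\<Sum>\<xi>\<in>Z. \<nu> \<xi>)"
    by (rule sum.cong) (simp_all add: weight_normalised flip: sum_distrib_left)
  finally show ?thesis .
qed

text \<open>The value vectors \<open>e(\<xi>)\<close> are right eigenvectors, so a left kernel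
  vector \<open>u\<close> is taken. Then \<open>\<nu>(\<xi>)\<close> times the product of
  \<open>u\<close> and \<open>e(\<xi>)\<close> is 0, and the weights recover every entry of
  \<open>u\<close> from these products.\<close>

lemma det_nonzero_of_eigenvalues_nonzero:
  assumes carrier: "M \<in> carrier_mat d d" and M: "\<And>\<xi>. \<xi> \<in> Z \<Longrightarrow> eigen_mat M \<xi> (\<nu> \<xi>)"
    and nonzero: "\<And>\<xi>. \<xi> \<in> Z \<Longrightarrow> \<nu> \<xi> \<noteq> 0"
  shows "Determinant.det M \<noteq> 0"
proof
  assume "Determinant.det M = 0"
  then have "Determinant.det M\<^sup>T = 0" using Determinant.det_transpose[OF carrier] by simp
  then obtain u where u: "u \<in> carrier_vec d" "u \<noteq> 0\<^sub>v d" "M\<^sup>T *\<^sub>v u = 0\<^sub>v d"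
    using det_0_iff_vec_prod_zero_field[of "M\<^sup>T" d] carrier by auto
  have col: "(\<Sum>\<alpha><d. to_ac (vec_index u \<alpha>) * to_ac (M $$ (\<alpha>, \<beta>))) = 0" if \<beta>: "\<beta> < d" for \<beta>
  proof -
    have "vec_index (M\<^sup>T *\<^sub>v u) \<beta> = (\<Sum>\<alpha><d. M $$ (\<alpha>, \<beta>) * vec_index u \<alpha>)"
      using carrier u(1) \<beta> by (simp add: scalar_prod_def lessThan_atLeast0)
    then have "(\<Sum>\<alpha><d. vec_index u \<alpha> * M $$ (\<alpha>, \<beta>)) = 0" using u(3) \<beta> by (simp add: mult.commute)
    then have "to_ac (\<Sum>\<alpha><d. vec_index u \<alpha> * M $$ (\<alpha>, \<beta>)) = 0" by simp
    then show ?thesis by (simp add: to_ac_sum)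
  qed
  have zero: "(\<Sum>\<alpha><d. to_ac (vec_index u \<alpha>) * basis_value \<alpha> \<xi>) = 0" if \<xi>: "\<xi> \<in> Z" for \<xi>
  proof -
    have "\<nu> \<xi> * (\<Sum>\<alpha><d. to_ac (vec_index u \<alpha>) * basis_value \<alpha> \<xi>) =
        (\<Sum>\<alpha><d. to_ac (vec_index u \<alpha>) * (\<Sum>\<beta><d. to_ac (M $$ (\<alpha>, \<beta>)) * basis_value \<beta> \<xi>))"
      using M[OF \<xi>] unfolding sum_distrib_left by (intro sum.cong) (simp_all add: eigen_mat_def flip: sum_distrib_left)
    also have "\<dots> = (\<Sum>\<alpha><d. \<Sum>\<beta><d. to_ac (vec_index u \<alpha>) * to_ac (M $$ (\<alpha>, \<beta>)) * basis_value \<beta> \<xi>)"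
      by (simp only: sum_distrib_left mult.assoc)
    also have "\<dots> = (\<Sum>\<beta><d. \<Sum>\<alpha><d. to_ac (vec_index u \<alpha>) * to_ac (M $$ (\<alpha>, \<beta>)) * basis_value \<beta> \<xi>)" by (rule sum.swap)
    also have "\<dots> = 0" by (rule sum.neutral) (simp add: col flip: sum_distrib_right)
    finally show ?thesis using nonzero[OF \<xi>] by simp
  qed
  have "vec_index u \<gamma> = 0" if \<gamma>: "\<gamma> < d" for \<gamma>
  proof -
    have "to_ac (vec_index u \<gamma>) = (\<Sum>\<alpha><d. if \<alpha> = \<gamma> then to_ac (vec_index u \<gamma>) else 0)" using \<gamma> by simp
    also have "\<dots> = (\<Sum>\<alpha><d. to_ac (vec_index u \<alpha>) * (\<Sum>\<xi>\<in>Z. weight \<gamma> \<xi> * basis_value \<alpha> \<xi>))"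
      by (rule sum.cong) (auto simp: weight_basis_value[OF _ \<gamma>])
    also have "\<dots> = (\<Sum>\<alpha><d. \<Sum>\<xi>\<in>Z. weight \<gamma> \<xi> * (to_ac (vec_index u \<alpha>) * basis_value \<alpha> \<xi>))"
      by (simp only: sum_distrib_left mult.left_commute)
    also have "\<dots> = (\<Sum>\<xi>\<in>Z. \<Sum>\<alpha><d. weight \<gamma> \<xi> * (to_ac (vec_index u \<alpha>) * basis_value \<alpha> \<xi>))" by (rule sum.swap)
    also have "\<dots> = 0" by (rule sum.neutral) (simp add: zero flip: sum_distrib_left)
    finally show ?thesis by simp
  qed
  then have "u = 0\<^sub>v d" using u(1) by (intro eq_vecI) auto
  with u(2) show False by contradiction
qed

text \<open>Nonzero eigenvalues make the determinant nonzero, so \<open>mat_inverse\<close> does not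
  return \<open>None\<close>. Applying the left inverse to
  \<open>M e(\<xi>) = \<nu>(\<xi>) e(\<xi>)\<close> inverts the eigenvalue.\<close>

lemma mat_inverse_eigen:
  assumes carrier: "M \<in> carrier_mat d d" and M: "\<And>\<xi>. \<xi> \<in> Z \<Longrightarrow> eigen_mat M \<xi> (\<nu> \<xi>)"
    and nonzero: "\<And>\<xi>. \<xi> \<in> Z \<Longrightarrow> \<nu> \<xi> \<noteq> 0"
  shows "the (mat_inverse M) \<in> carrier_mat d d"
    and "\<xi> \<in> Z \<Longrightarrow> eigen_mat (the (mat_inverse M)) \<xi> (inverse (\<nu> \<xi>))"
proof -
  have "M \<in> Units (ring_mat TYPE('k) d ())"
    by (rule det_non_zero_imp_unit[OF carrier det_nonzero_of_eigenvalues_nonzero[OF carrier M nonzero]])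
  then obtain N where N: "mat_inverse M = Some N"
    using mat_inverse(1)[OF carrier, where b = "()"] by (cases "mat_inverse M") auto
  have NM: "N * M = 1\<^sub>m d" and cN: "N \<in> carrier_mat d d" using mat_inverse(2)[OF carrier N] by auto
  show "the (mat_inverse M) \<in> carrier_mat d d" using N cN by simp
  show "eigen_mat (the (mat_inverse M)) \<xi> (inverse (\<nu> \<xi>))" if \<xi>: "\<xi> \<in> Z"
    unfolding eigen_mat_def N option.sel
  proof (intro conjI allI impI cN)
    fix \<alpha> assume \<alpha>: "\<alpha> < d"
    have "basis_value \<alpha> \<xi> = (\<Sum>\<beta><d. to_ac ((N * M) $$ (\<alpha>, \<beta>)) * basis_value \<beta> \<xi>)"
      using eigen_mat_one[of \<xi>] \<alpha> unfolding NM eigen_mat_def by simp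
    also have "\<dots> = (\<Sum>\<beta><d. \<Sum>k<d. to_ac (N $$ (\<alpha>, k)) * to_ac (M $$ (k, \<beta>)) * basis_value \<beta> \<xi>)"
      by (rule sum.cong) (simp_all add: index_mult_mat_sum[OF cN carrier \<alpha>] to_ac_sum sum_distrib_right del: index_mult_mat)
    also have "\<dots> = (\<Sum>k<d. \<Sum>\<beta><d. to_ac (N $$ (\<alpha>, k)) * to_ac (M $$ (k, \<beta>)) * basis_value \<beta> \<xi>)" by (rule sum.swap)
    also have "\<dots> = (\<Sum>k<d. to_ac (N $$ (\<alpha>, k)) * (\<nu> \<xi> * basis_value k \<xi>))"
      using M[OF \<xi>] by (intro sum.cong) (auto simp: eigen_mat_def mult.assoc simp flip: sum_distrib_left)
    also have "\<dots> = \<nu> \<xi> * (\<Sum>k<d. to_ac (N $$ (\<alpha>, k)) * basis_value k \<xi>)"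
      by (simp only: sum_distrib_left mult.left_commute)
    finally show "(\<Sum>k<d. to_ac (N $$ (\<alpha>, k)) * basis_value k \<xi>) = inverse (\<nu> \<xi>) * basis_value \<alpha> \<xi>"
      using nonzero[OF \<xi>] by simp
  qed
qed

text \<open>\<open>rat_at_mats\<close> commits to an unknown representation \<open>a'/b'\<close>.
  The trace depends only on its values at the zeros, and there cross-multiplication identifies
  \<open>a'/b'\<close> with \<open>a/b\<close>.\<close>

theorem trace_rat_at_mats:
  assumes T: "\<And>i. T i = companion_matrix mle G es i"
    and b: "b \<noteq> 0" "\<And>\<xi>. \<xi> \<in> Z \<Longrightarrow> mpeval to_ac \<xi> b \<noteq> 0"
  shows "to_ac (mat_trace (rat_at_mats Z d T (Fract a b))) = (\<Sum>\<xi>\<in>Z. mpeval to_ac \<xi> a / mpeval to_ac \<xi> b)"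
proof -
  interpret to_ac: comm_ring_hom to_ac by (rule to_ac_hom)
  have eigen: "eigen_mat (mpoly_at_mats d T q) \<xi> (mpeval to_ac \<xi> q)" if "\<xi> \<in> Z" for \<xi> q
    unfolding T by (rule eigen_mpoly_at_mats) (rule eigen_companion_matrix[OF that])
  have carrier: "mpoly_at_mats d T q \<in> carrier_mat d d" for q by (simp add: mpoly_at_mats_def)
  let ?M = "rat_at_mats Z d T (Fract a b)"
  have "\<exists>a' b'. b' \<noteq> 0 \<and> Fract a b = Fract a' b' \<and> (\<forall>\<xi>\<in>Z. mpeval to_ac \<xi> b' \<noteq> 0) \<and>
      ?M = mpoly_at_mats d T a' * the (mat_inverse (mpoly_at_mats d T b'))"
    unfolding rat_at_mats_def by (rule someI_ex) (use b in blast)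
  then obtain a' b' where b': "b' \<noteq> 0" "\<And>\<xi>. \<xi> \<in> Z \<Longrightarrow> mpeval to_ac \<xi> b' \<noteq> 0" and eq: "Fract a b = Fract a' b'"
    and M: "?M = mpoly_at_mats d T a' * the (mat_inverse (mpoly_at_mats d T b'))" by blast
  note inv = mat_inverse_eigen[OF carrier eigen b'(2)]
  have "?M \<in> carrier_mat d d" unfolding M using carrier inv(1) by (rule mult_carrier_mat)
  then have "to_ac (mat_trace ?M) = (\<Sum>\<xi>\<in>Z. mpeval to_ac \<xi> a' * inverse (mpeval to_ac \<xi> b'))"
    by (rule trace_eq_sum_eigenvalues) (unfold M, intro eigen_mat_mult eigen inv)
  also have "\<dots> = (\<Sum>\<xi>\<in>Z. mpeval to_ac \<xi> a / mpeval to_ac \<xi> b)"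
  proof (rule sum.cong)
    fix \<xi> assume \<xi>: "\<xi> \<in> Z"
    have "a * b' = a' * b" using eq b(1) b'(1) by (simp add: eq_fract)
    then have "mpeval to_ac \<xi> a * mpeval to_ac \<xi> b' = mpeval to_ac \<xi> a' * mpeval to_ac \<xi> b"
      by (metis to_ac.mpeval_mult)
    then show "mpeval to_ac \<xi> a' * inverse (mpeval to_ac \<xi> b') = mpeval to_ac \<xi> a / mpeval to_ac \<xi> b"
      using b(2)[OF \<xi>] b'(2)[OF \<xi>] by (simp add: field_simps)
  qed simp
  finally show ?thesis .
qed

end

section \<open>Jacobians\<close>

no_notation vec_index (infixl "$" 100)
unbundle no fps_syntax

lemma (in comm_ring_hom) det_hom:
  "Determinants.det (\<chi> i j. hom (A $ i $ j)) = hom (Determinants.det A)"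
  by (simp add: Determinants.det_def hom_sum hom_prod hom_mult hom_of_int)

text \<open>Used twice with \<open>jacobian_numerator\<close> as \<open>N\<close>: over the rational
  functions with \<open>c\<close> the inverse determinant, and at a zero with \<open>c\<close> the
  negated inverse of its value.\<close>

lemma minor_scaled:
  fixes M :: "'b::comm_ring_1^'n::{finite,linorder}^'m::{finite,linorder}" and N :: "'a::comm_ring_1^'n::{finite,linorder}^'m::{finite,linorder}"
  assumes "comm_ring_hom h" and M: "\<And>i j. M $ i $ j = c * h (N $ i $ j)" and card: "card I = card J"
  shows "minor M I J = c ^ card I * h (minor N I J)"
proof -
  interpret comm_ring_hom h by fact
  let ?N = "mat (card I) (card J) (\<lambda>(a, b). N $ (sorted_list_of_set I ! a) $ (sorted_list_of_set J ! b))"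
  have "mat (card I) (card J) (\<lambda>(a, b). M $ (sorted_list_of_set I ! a) $ (sorted_list_of_set J ! b)) = c \<cdot>\<^sub>m map_mat h ?N"
    by (rule eq_matI) (auto simp: M)
  then show ?thesis unfolding minor_def by (simp add: card)
qed

lemma ypoly_incl_hom: "comm_ring_hom ypoly_incl"
proof -
  interpret frac: comm_ring_hom frac by (rule frac_hom)
  show ?thesis unfolding ypoly_incl_def by (rule frac.map_mpoly_hom)
qed

lemma mpeval_ypoly_incl: "mpeval to_ac \<xi> (ypoly_incl q) = mpeval (\<lambda>c. to_ac (frac c)) \<xi> q"
  unfolding ypoly_incl_def by (rule mpeval_map) simp_all

lemma mpderiv_ypoly_incl: "mpderiv i (ypoly_incl q) = ypoly_incl (mpderiv i q)"
proof -
  interpret frac: comm_ring_hom frac by (rule frac_hom)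
  interpret incl: comm_ring_hom ypoly_incl by (rule ypoly_incl_hom)
  show ?thesis
  proof (induction q rule: mpoly_single_induct)
    case (single t c)
    show ?case by (simp add: ypoly_incl_def mpderiv_single frac.hom_mult frac.hom_of_nat)
  qed (simp add: incl.hom_add mpderiv_add)
qed

lemma mpderiv_univariate: "mpderiv j (univariate i p) = (if j = i then univariate i (pderiv p) else 0)"
  by (induction p)
    (auto simp: univariate_simps mpderiv_add mpderiv_mult mpderiv_mvar pderiv_pCons univariate_add mconst_simps)

lemma pderiv_map_poly_to_ac: "map_poly to_ac (pderiv p) = pderiv (map_poly to_ac p)"
  by (rule poly_eqI) (simp add: coeff_map_poly coeff_pderiv del: of_nat_Suc)

section \<open>Nondegeneracy of the Jacobian on the zero set\<close>

lemma det_jacobian_nonzero: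
  fixes f :: "'v::finite \<Rightarrow> ('v, 'k::field) mpoly"
  assumes \<I>: "\<I> = ideal_gen (range f)" and zero_dim: "zero_dimensional \<I>" and radical: "radical_ideal \<I>"
    and char: "CHAR('k) = 0" and \<xi>: "\<xi> \<in> zero_set \<I>"
  shows "Determinants.det (\<chi> l i. mpeval to_ac \<xi> (mpderiv i (f l))) \<noteq> 0" (is "Determinants.det ?A \<noteq> 0")
proof
  interpret to_ac: comm_ring_hom to_ac by (rule to_ac_hom)
  have ideal: "is_ideal \<I>" unfolding \<I> by (rule is_ideal_ideal_gen)
  assume "Determinants.det ?A = 0"
  then have "\<not> (\<exists>B. B ** ?A = Finite_Cartesian_Product.mat 1)"
    using invertible_det_nz[of ?A] invertible_left_inverse[of ?A] by blast
  then obtain v where v: "?A *v v = 0" "v \<noteq> 0" unfolding matrix_left_invertible_ker by blast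
  have row: "(\<Sum>i\<in>UNIV. mpeval to_ac \<xi> (mpderiv i (f l)) * v $ i) = 0" for l
    using v(1) by (simp add: Finite_Cartesian_Product.vec_eq_iff matrix_vector_mult_def)
  text \<open>A kernel vector of the Jacobian is a point derivation that kills the ideal.\<close>
  have kills: "(\<Sum>i\<in>UNIV. mpeval to_ac \<xi> (mpderiv i h) * v $ i) = 0" if "h \<in> \<I>" for h
    using that unfolding \<I>
  proof (induction h rule: ideal_gen_induct)
    case zero
    show ?case by (simp add: mpeval_def)
  next
    case (add c s b)
    then obtain l where s: "s = f l" by blast
    \<comment> \<open>Since \<open>s\<close> vanishes at \<open>\<xi>\<close>, the terms of the
      product rule that differentiate \<open>c\<close> drop out.\<close>
    have "s \<in> \<I>" unfolding \<I> using add(1) by (rule ideal_gen_closed)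
    then have "mpeval to_ac \<xi> s = 0" using \<xi> by (simp add: zero_set_def)
    then have "(\<Sum>i\<in>UNIV. mpeval to_ac \<xi> (mpderiv i (c * s + b)) * v $ i) =
        (\<Sum>i\<in>UNIV. mpeval to_ac \<xi> c * (mpeval to_ac \<xi> (mpderiv i s) * v $ i) + mpeval to_ac \<xi> (mpderiv i b) * v $ i)"
      by (intro sum.cong refl)
        (simp add: mpderiv_add mpderiv_mult to_ac.mpeval_add to_ac.mpeval_mult distrib_right mult.assoc)
    also have "\<dots> = 0" using row add.IH by (simp add: sum.distrib s flip: sum_distrib_left)
    finally show ?case .
  qed
  have "v $ i = 0" for i
  proof -
    obtain p where p: "univariate i p \<in> \<I>" "simple_roots (map_poly to_ac p)"
      using exists_simple_univariate_in_ideal[OF ideal zero_dim radical char] by blast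
    have "poly (map_poly to_ac p) (\<xi> i) = 0"
      using p(1) \<xi> unfolding mpeval_univariate[symmetric] zero_set_def by blast
    then have "poly (pderiv (map_poly to_ac p)) (\<xi> i) \<noteq> 0" using p(2) by (simp add: simple_roots_def)
    moreover have "(\<Sum>j\<in>UNIV. mpeval to_ac \<xi> (mpderiv j (univariate i p)) * v $ j) =
        (\<Sum>j\<in>UNIV. if j = i then poly (pderiv (map_poly to_ac p)) (\<xi> i) * v $ i else 0)"
      by (rule sum.cong) (simp_all add: mpderiv_univariate mpeval_univariate pderiv_map_poly_to_ac, simp add: mpeval_def)
    ultimately show ?thesis using kills[OF p(1)] by simp
  qed
  then have "v = 0" by (simp add: Finite_Cartesian_Product.vec_eq_iff)
  with v(2) show False by contradiction
qed

section \<open>Chain rule and values of rational functions\<close>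

text \<open>The total derivative of \<open>q(\<xi>(y), y)\<close>: the first summand differentiates
  the coefficients, the sum differentiates the point. Both sides obey the same sum and product rules
  in \<open>q\<close>, which reduces the claim to constants and variables.\<close>

lemma algfun_deriv_mpeval:
  fixes q :: "('m::finite, ('n::{finite,linorder}, complex) mpoly) mpoly"
  shows "algfun_deriv j (mpeval (\<lambda>c. to_ac (frac c)) \<xi> q) =
    mpeval (\<lambda>c. to_ac (frac c)) \<xi> (Poly_Mapping.map (mpderiv j) q) +
    (\<Sum>i\<in>UNIV. mpeval (\<lambda>c. to_ac (frac c)) \<xi> (mpderiv i q) * algfun_deriv j (\<xi> i))"
proof -
  interpret emb: comm_ring_hom "\<lambda>c. to_ac (frac c)"
    by (rule comm_ring_hom_compose[OF to_ac_hom frac_hom])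
  note D = derivation_simps[OF algfun_deriv(1)]
  show ?thesis
  proof (induction q rule: mpoly_induct)
    case (const c)
    show ?case
      by (simp add: mpeval_mconst map_mconst algfun_deriv(2) ratfun_deriv_frac) (simp add: mpeval_def)
  next
    case (var v)
    have "Poly_Mapping.map (mpderiv j) (mvar v :: ('m, ('n, complex) mpoly) mpoly) = 0"
      by (simp add: mvar_def)
    moreover have "(\<Sum>i\<in>UNIV. mpeval (\<lambda>c. to_ac (frac c)) \<xi> (mpderiv i (mvar v :: ('m, ('n, complex) mpoly) mpoly)) * algfun_deriv j (\<xi> i)) =
        (\<Sum>i\<in>UNIV. if i = v then algfun_deriv j (\<xi> v) else 0)"
      by (rule sum.cong) (use mpeval_mconst[of "\<lambda>c. to_ac (frac c)" \<xi> 1] in \<open>auto simp: mpderiv_mvar mconst_simps mpeval_def[of _ _ 0]\<close>)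
    ultimately show ?case by (simp add: emb.mpeval_mvar mpeval_def[of _ _ 0])
  next
    case (add p q)
    then show ?case
      by (simp add: emb.mpeval_add D map_add_mpoly mpderiv_add distrib_right sum.distrib)
  next
    case (mult p q)
    have "Poly_Mapping.map (mpderiv j) (p * q) = Poly_Mapping.map (mpderiv j) p * q + p * Poly_Mapping.map (mpderiv j) q"
      by (rule map_derivation_mult) (simp_all add: mpderiv_add mpderiv_mult)
    then show ?case using mult
      by (simp add: emb.mpeval_add emb.mpeval_mult D mpderiv_mult algebra_simps sum.distrib sum_distrib_left sum_distrib_right)
  qed
qed

lemma rateval_Fract:
  fixes \<phi> :: "'a::idom \<Rightarrow> 'b::field"
  assumes \<phi>: "comm_ring_hom \<phi>" and b: "b \<noteq> 0" "mpeval \<phi> \<xi> b \<noteq> 0"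
  shows "rateval \<phi> \<xi> (Fract a b) = mpeval \<phi> \<xi> a / mpeval \<phi> \<xi> b"
  unfolding rateval_def
proof (rule someI2_ex)
  show "\<exists>c a' b'. b' \<noteq> 0 \<and> Fract a b = Fract a' b' \<and> mpeval \<phi> \<xi> b' \<noteq> 0 \<and> c = mpeval \<phi> \<xi> a' / mpeval \<phi> \<xi> b'"
    using b by blast
next
  interpret \<phi>: comm_ring_hom \<phi> by fact
  fix c assume "\<exists>a' b'. b' \<noteq> 0 \<and> Fract a b = Fract a' b' \<and> mpeval \<phi> \<xi> b' \<noteq> 0 \<and> c = mpeval \<phi> \<xi> a' / mpeval \<phi> \<xi> b'"
  then obtain a' b' where b': "b' \<noteq> 0" "mpeval \<phi> \<xi> b' \<noteq> 0" and eq: "Fract a b = Fract a' b'"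
    and c: "c = mpeval \<phi> \<xi> a' / mpeval \<phi> \<xi> b'" by blast
  have "a * b' = a' * b" using eq b b' by (simp add: eq_fract)
  then have "mpeval \<phi> \<xi> a * mpeval \<phi> \<xi> b' = mpeval \<phi> \<xi> a' * mpeval \<phi> \<xi> b" by (metis \<phi>.mpeval_mult)
  then show "c = mpeval \<phi> \<xi> a / mpeval \<phi> \<xi> b" using b b' by (simp add: c field_simps)
qed

lemma ratfun_const_hom: "comm_ring_hom ratfun_const"
  unfolding ratfun_const_def by (rule comm_ring_hom_compose[OF frac_hom mconst_hom])

lemma map_ratfun_const_eq_0_iff:
  "Poly_Mapping.map (ratfun_const :: complex \<Rightarrow> 'n::{finite,linorder} ratfun) b = 0 \<longleftrightarrow> b = 0"
proof -
  have "(ratfun_const c :: 'n ratfun) = 0 \<longleftrightarrow> c = 0" for c by (simp add: ratfun_const_def mconst_eq_0_iff)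
  moreover have "(\<forall>k\<in>Poly_Mapping.keys b. Poly_Mapping.lookup b k = 0) \<longleftrightarrow> b = 0"
    by (metis all_not_in_conv in_keys_iff keys_eq_empty)
  ultimately show ?thesis by (simp add: map_eq_zero_iff)
qed

text \<open>Evaluation at the generic point is the coefficientwise inclusion. It keeps the
  denominator nonzero because \<open>ratfun_const\<close> is injective.\<close>

lemma xratfun_incl_Fract:
  fixes a b :: "('m::{finite,linorder}, complex) mpoly"
  assumes "b \<noteq> 0"
  shows "(xratfun_incl (Fract a b) :: ('m, 'n::{finite,linorder}) xratfun) = Fract (Poly_Mapping.map ratfun_const a) (Poly_Mapping.map ratfun_const b)"
proof -
  interpret c: comm_ring_hom "ratfun_const :: complex \<Rightarrow> 'n ratfun" by (rule ratfun_const_hom)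
  have hom: "comm_ring_hom (\<lambda>c. frac (mconst (ratfun_const c :: 'n ratfun) :: ('m, 'n ratfun) mpoly))"
    by (rule comm_ring_hom_compose[OF frac_hom comm_ring_hom_compose[OF mconst_hom ratfun_const_hom]])
  then interpret emb: comm_ring_hom "\<lambda>c. frac (mconst (ratfun_const c :: 'n ratfun) :: ('m, 'n ratfun) mpoly)" .
  have ev: "mpeval (\<lambda>c. frac (mconst (ratfun_const c :: 'n ratfun))) (\<lambda>i. frac (mvar i :: ('m, 'n ratfun) mpoly)) q = frac (Poly_Mapping.map ratfun_const q)" for q
    by (rule mpoly_hom_eqI[OF emb.mpeval_hom comm_ring_hom_compose[OF frac_hom c.map_mpoly_hom]])
      (simp_all add: mpeval_mconst map_mconst emb.mpeval_mvar c.map_mvar mconst_simps)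
  have b: "(Poly_Mapping.map ratfun_const b :: ('m, 'n ratfun) mpoly) \<noteq> 0"
    using assms by (simp add: map_ratfun_const_eq_0_iff)
  then have "mpeval (\<lambda>c. frac (mconst (ratfun_const c :: 'n ratfun))) (\<lambda>i. frac (mvar i :: ('m, 'n ratfun) mpoly)) b \<noteq> 0"
    unfolding ev by simp
  from rateval_Fract[OF hom assms this] show ?thesis
    unfolding xratfun_incl_def ev Fract_conv_frac[OF b] .
qed

section \<open>Cramer's rule and implicit differentiation\<close>

text \<open>Column \<open>j\<close> of the product solves the linear system with right-hand side
  column \<open>j\<close> of \<open>B\<close>. The result is a quotient of polynomial expressions in
  the entries, which can be evaluated at points.\<close>

lemma matrix_inv_mult_cramer:
  fixes A :: "'a::field^'n^'n" and B :: "'a^'k^'n"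
  assumes "Determinants.det A \<noteq> 0"
  shows "(matrix_inv A ** B) $ i $ j = Determinants.det (\<chi> l k. if k = i then B $ l $ j else A $ l $ k) / Determinants.det A"
proof -
  let ?X = "matrix_inv A ** B"
  have "invertible A" using assms by (simp add: invertible_det_nz)
  then have "\<exists>A'. A ** A' = Finite_Cartesian_Product.mat 1 \<and> A' ** A = Finite_Cartesian_Product.mat 1" by (simp add: invertible_def)
  then have "A ** matrix_inv A = Finite_Cartesian_Product.mat 1" unfolding matrix_inv_def by (rule someI2_ex) blast
  then have AX: "A ** ?X = B" by (simp add: matrix_mul_assoc)
  have "(A *v (\<chi> k. ?X $ k $ j)) $ l = B $ l $ j" for l
    by (subst (2) AX[symmetric]) (simp add: matrix_vector_mult_def matrix_matrix_mult_def[of A])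
  then have "Determinants.det (\<chi> l k. if k = i then B $ l $ j else A $ l $ k) = ?X $ i $ j * Determinants.det A"
    using cramer_lemma[of i A "\<chi> k. ?X $ k $ j"] by (simp cong: if_cong)
  then show ?thesis using assms by simp
qed

text \<open>The numerators of the entries of \<open>(\<partial>F/\<partial>x)\<^sup>-\<^sup>1 \<partial>F/\<partial>y\<close> over the denominator \<open>det (\<partial>F/\<partial>x)\<close>, by
  Cramer's rule.\<close>

definition jacobian_det :: "('m::{finite,linorder} \<Rightarrow> ('m, 'n::{finite,linorder}) ypoly) \<Rightarrow> ('m, 'n ratfun) mpoly" where
  "jacobian_det f = Determinants.det (\<chi> l i. ypoly_incl (mpderiv i (f l)))"

definition jacobian_numerator ::
  "('m::{finite,linorder} \<Rightarrow> ('m, 'n::{finite,linorder}) ypoly) \<Rightarrow> ('m, 'n ratfun) mpoly^'n::{finite,linorder}^'m::{finite,linorder}" where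
  "jacobian_numerator f = (\<chi> i j. Determinants.det (\<chi> l k. if k = i
     then ypoly_incl (Poly_Mapping.map (mpderiv j) (f l)) else ypoly_incl (mpderiv k (f l))))"

lemma matrix_inv_jacobian:
  assumes "jacobian_det f \<noteq> 0"
  shows "(matrix_inv (jacobian_x f) ** jacobian_y f) $ i $ j = inverse (frac (jacobian_det f)) * frac (jacobian_numerator f $ i $ j)"
proof -
  interpret frac: comm_ring_hom frac by (rule frac_hom)
  have det: "Determinants.det (jacobian_x f) = frac (jacobian_det f)"
    unfolding jacobian_det_def frac.det_hom[symmetric] jacobian_x_def by simp
  have "Determinants.det (\<chi> l k. if k = i then jacobian_y f $ l $ j else jacobian_x f $ l $ k) = frac (jacobian_numerator f $ i $ j)"
    unfolding jacobian_numerator_def vec_lambda_beta frac.det_hom[symmetric] jacobian_x_def jacobian_y_def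
    by (simp add: if_distrib[of frac] cong: if_cong)
  then show ?thesis
    using assms by (subst matrix_inv_mult_cramer) (simp_all add: det field_simps)
qed

text \<open>Exhibits a fraction whose denominator is nonzero at every zero, as the trace formula
  requires; the definition through \<open>matrix_inv\<close> does not display one.\<close>

lemma omega_minor_Fract:
  fixes f :: "'m::{finite,linorder} \<Rightarrow> ('m, 'n::{finite,linorder}) ypoly"
  assumes \<Delta>: "jacobian_det f \<noteq> 0" and b: "b \<noteq> 0" and card: "card I = card J"
  shows "omega_minor f (Fract a b) I J =
    Fract ((- 1) ^ card I * Poly_Mapping.map ratfun_const a * minor (jacobian_numerator f) I J)
      (Poly_Mapping.map ratfun_const b * jacobian_det f ^ card I)"
proof -
  interpret frac: comm_ring_hom frac by (rule frac_hom)
  have b': "(Poly_Mapping.map ratfun_const b :: ('m, 'n ratfun) mpoly) \<noteq> 0" using b by (simp add: map_ratfun_const_eq_0_iff)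
  show ?thesis
    unfolding omega_minor_def minor_scaled[OF frac_hom matrix_inv_jacobian[OF \<Delta>] card] xratfun_incl_Fract[OF b]
    using b' \<Delta>
    by (simp add: Fract_conv_frac frac.hom_mult frac.hom_power frac.hom_uminus power_inverse field_simps)
qed

text \<open>Differentiating \<open>F(\<xi>(y), y) = 0\<close> shows that
  \<open>- \<partial>\<xi>/\<partial>y_j\<close> solves the system whose Cramer numerators are the
  values of \<open>jacobian_numerator\<close> at \<open>\<xi>\<close>. The sign
  \<open>(-1)^p\<close> of the theorem originates here.\<close>

lemma minor_jacobian_point:
  assumes \<xi>: "\<xi> \<in> zero_set (system_ideal f)" and \<Delta>: "mpeval to_ac \<xi> (jacobian_det f) \<noteq> 0" and card: "card I = card J"
  shows "minor (jacobian_point \<xi>) I J =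
    (- inverse (mpeval to_ac \<xi> (jacobian_det f))) ^ card I * mpeval to_ac \<xi> (minor (jacobian_numerator f) I J)"
proof (rule minor_scaled[OF _ _ card])
  interpret to_ac: comm_ring_hom to_ac by (rule to_ac_hom)
  show hom: "comm_ring_hom (mpeval to_ac \<xi>)" by (rule to_ac.mpeval_hom)
  then interpret ev: comm_ring_hom "mpeval to_ac \<xi>" .
  fix k j
  let ?A = "\<chi> l i. mpeval to_ac \<xi> (ypoly_incl (mpderiv i (f l)))"
  let ?x = "\<chi> i. - algfun_deriv j (\<xi> i)"
  have det: "Determinants.det ?A = mpeval to_ac \<xi> (jacobian_det f)"
    unfolding jacobian_det_def ev.det_hom[symmetric] by simp
  have "(?A *v ?x) $ l = mpeval to_ac \<xi> (ypoly_incl (Poly_Mapping.map (mpderiv j) (f l)))" for l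
  proof -
    have "ypoly_incl (f l) \<in> system_ideal f" unfolding system_ideal_def by (rule ideal_gen_closed) blast
    then have "mpeval to_ac \<xi> (ypoly_incl (f l)) = 0" using \<xi> by (simp add: zero_set_def)
    then have "mpeval (\<lambda>c. to_ac (frac c)) \<xi> (f l) = 0" by (simp add: mpeval_ypoly_incl)
    then have "mpeval (\<lambda>c. to_ac (frac c)) \<xi> (Poly_Mapping.map (mpderiv j) (f l)) +
        (\<Sum>i\<in>UNIV. mpeval (\<lambda>c. to_ac (frac c)) \<xi> (mpderiv i (f l)) * algfun_deriv j (\<xi> i)) = 0"
      using algfun_deriv_mpeval[of j \<xi> "f l"] derivation_simps(3)[OF algfun_deriv(1)[of j]] by simp
    then have "(\<Sum>i\<in>UNIV. mpeval (\<lambda>c. to_ac (frac c)) \<xi> (mpderiv i (f l)) * algfun_deriv j (\<xi> i)) =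
        - mpeval (\<lambda>c. to_ac (frac c)) \<xi> (Poly_Mapping.map (mpderiv j) (f l))"
      by (simp add: eq_neg_iff_add_eq_0 add.commute)
    then show ?thesis by (simp add: matrix_vector_mult_def mpeval_ypoly_incl sum_negf)
  qed
  then have "mpeval to_ac \<xi> (jacobian_numerator f $ k $ j) = - algfun_deriv j (\<xi> k) * Determinants.det ?A"
    using cramer_lemma[of k ?A ?x]
    by (simp add: jacobian_numerator_def if_distrib[of "mpeval to_ac \<xi>"] flip: ev.det_hom cong: if_cong)
  then show "jacobian_point \<xi> $ k $ j = - inverse (mpeval to_ac \<xi> (jacobian_det f)) * mpeval to_ac \<xi> (jacobian_numerator f $ k $ j)"
    using \<Delta> by (simp add: jacobian_point_def det)
qed

theorem mainTheorem6:
  fixes f :: "'m::{finite,linorder} \<Rightarrow> ('m, 'n::{finite,linorder}) ypoly"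
    and \<I> :: "('m, 'n ratfun) mpoly set"
    and d p :: nat
    and mle :: "'m monom \<Rightarrow> 'm monom \<Rightarrow> bool"
    and G :: "('m, 'n ratfun) mpoly set"
    and es :: "'m monom list"
    and T :: "'m \<Rightarrow> 'n ratfun mat"
    and I :: "'m set"
    and w :: "('m, complex) mpoly fract"
  assumes ideal: "\<I> = system_ideal f"
    and zero_dim: "zero_dimensional \<I>"
    and radical: "radical_ideal \<I>"
    and d_points: "finite (zero_set \<I>)" "card (zero_set \<I>) = d"
    and ordering: "monomial_ordering mle"
    and groebner: "groebner_basis mle \<I> G"
    and standard_basis: "distinct es" "set es = standard_monoms mle G"
    and companion: "\<And>i. T i = companion_matrix mle G es i"
    and p_le: "p \<le> CARD('m)"
    and I: "card I = p"
    and denominator: "\<exists>a b. b \<noteq> 0 \<and> w = Fract a b \<and>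
          (\<forall>\<xi>\<in>zero_set \<I>. mpeval (\<lambda>c. to_ac (ratfun_const c)) \<xi> b \<noteq> 0)"
  shows "pushforward \<I> w I =
    (\<Sum>J\<in>{J :: 'n set. card J = p}. Poly_Mapping.single J
       (to_ac (mat_trace (rat_at_mats (zero_set \<I>) (length es) T (omega_minor f w I J)))))"
proof -
  have is_ideal: "is_ideal \<I>" unfolding ideal system_ideal_def by (rule is_ideal_ideal_gen)
  interpret C: companion mle \<I> G es
    by unfold_locales (fact is_ideal ordering groebner zero_dim radical d_points standard_basis CHAR_ratfun)+
  obtain a b where b: "b \<noteq> 0" and w: "w = Fract a b"
    and b_nz: "\<And>\<xi>. \<xi> \<in> zero_set \<I> \<Longrightarrow> mpeval (\<lambda>c. to_ac (ratfun_const c)) \<xi> b \<noteq> 0"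
    using denominator by blast
  have hom: "comm_ring_hom (\<lambda>c. to_ac (ratfun_const c :: 'n ratfun))"
    by (rule comm_ring_hom_compose[OF to_ac_hom ratfun_const_hom])
  interpret to_ac: comm_ring_hom to_ac by (rule to_ac_hom)
  interpret c: comm_ring_hom "ratfun_const :: complex \<Rightarrow> 'n ratfun" by (rule ratfun_const_hom)
  have map_const: "mpeval to_ac \<xi> (Poly_Mapping.map ratfun_const q) = mpeval (\<lambda>c. to_ac (ratfun_const c :: 'n ratfun)) \<xi> q"
    for q :: "('m, complex) mpoly" and \<xi> by (rule mpeval_map) simp_all
  have \<Delta>: "mpeval to_ac \<xi> (jacobian_det f) \<noteq> 0" if \<xi>: "\<xi> \<in> zero_set \<I>" for \<xi>
  proof -
    interpret ev: comm_ring_hom "mpeval to_ac \<xi> :: ('m, 'n ratfun) mpoly \<Rightarrow> 'n algfun" by (rule to_ac.mpeval_hom)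
    have "Determinants.det (\<chi> l i. mpeval to_ac \<xi> (mpderiv i (ypoly_incl (f l)))) \<noteq> 0"
      by (rule det_jacobian_nonzero[OF _ zero_dim radical CHAR_ratfun \<xi>]) (simp add: ideal system_ideal_def)
    then show ?thesis by (simp add: mpderiv_ypoly_incl jacobian_det_def flip: ev.det_hom)
  qed
  have coeff: "to_ac (mat_trace (rat_at_mats (zero_set \<I>) (length es) T (omega_minor f w I J))) =
      (\<Sum>\<xi>\<in>zero_set \<I>. rateval (\<lambda>c. to_ac (ratfun_const c)) \<xi> w * minor (jacobian_point \<xi>) I J)"
    if J: "card J = p" for J :: "'n set"
  proof (cases "zero_set \<I> = {}")
    \<comment> \<open>Without zeros the Jacobian determinant may vanish identically, leaving its
      inverse unspecified. An arbitrary representation of \<open>omega_minor\<close> then serves,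
      both sides being 0.\<close>
    case True
    obtain a' b' where "omega_minor f w I J = Fract a' b'" "b' \<noteq> 0" by (cases "omega_minor f w I J")
    then show ?thesis using C.trace_rat_at_mats[OF companion, of b' a'] True by simp
  next
    case False
    have card: "card I = card J" using I J by simp
    \<comment> \<open>A polynomial with a nonzero value at some zero of the system is itself
      nonzero.\<close>
    have \<Delta>0: "jacobian_det f \<noteq> 0" using False \<Delta> by (auto simp: mpeval_def)
    let ?num = "(- 1) ^ card I * Poly_Mapping.map ratfun_const a * minor (jacobian_numerator f) I J"
    let ?den = "Poly_Mapping.map ratfun_const b * jacobian_det f ^ card I"
    have den: "?den \<noteq> 0" using b \<Delta>0 by (simp add: map_ratfun_const_eq_0_iff)
    have ev_den: "mpeval to_ac \<xi> ?den = mpeval (\<lambda>c. to_ac (ratfun_const c)) \<xi> b * mpeval to_ac \<xi> (jacobian_det f) ^ card I"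
      and ev_num: "mpeval to_ac \<xi> ?num = (- 1) ^ card I * mpeval (\<lambda>c. to_ac (ratfun_const c)) \<xi> a * mpeval to_ac \<xi> (minor (jacobian_numerator f) I J)"
      for \<xi>
    proof -
      interpret ev: comm_ring_hom "mpeval to_ac \<xi> :: ('m, 'n ratfun) mpoly \<Rightarrow> 'n algfun" by (rule to_ac.mpeval_hom)
      show "mpeval to_ac \<xi> ?den = mpeval (\<lambda>c. to_ac (ratfun_const c)) \<xi> b * mpeval to_ac \<xi> (jacobian_det f) ^ card I"
        "mpeval to_ac \<xi> ?num = (- 1) ^ card I * mpeval (\<lambda>c. to_ac (ratfun_const c)) \<xi> a * mpeval to_ac \<xi> (minor (jacobian_numerator f) I J)"
        by (simp_all add: ev.hom_mult ev.hom_power ev.hom_uminus map_const)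
    qed
    have "to_ac (mat_trace (rat_at_mats (zero_set \<I>) (length es) T (omega_minor f w I J))) =
        (\<Sum>\<xi>\<in>zero_set \<I>. mpeval to_ac \<xi> ?num / mpeval to_ac \<xi> ?den)"
      unfolding w omega_minor_Fract[OF \<Delta>0 b card]
      by (rule C.trace_rat_at_mats[OF companion den]) (simp add: ev_den b_nz \<Delta>)
    also have "\<dots> = (\<Sum>\<xi>\<in>zero_set \<I>. rateval (\<lambda>c. to_ac (ratfun_const c)) \<xi> w * minor (jacobian_point \<xi>) I J)"
    proof (rule sum.cong[OF refl])
      fix \<xi> assume \<xi>: "\<xi> \<in> zero_set \<I>"
      show "mpeval to_ac \<xi> ?num / mpeval to_ac \<xi> ?den = rateval (\<lambda>c. to_ac (ratfun_const c)) \<xi> w * minor (jacobian_point \<xi>) I J"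
        unfolding ev_num ev_den w rateval_Fract[OF hom b b_nz[OF \<xi>]]
          minor_jacobian_point[OF \<xi>[unfolded ideal] \<Delta>[OF \<xi>] card]
        \<comment> \<open>Splits the power of the negated inverse determinant, coming from implicit
          differentiation, into the sign in \<open>omega_minor\<close> and the determinant power in
          its denominator.\<close>
        by (subst power_minus) (simp add: divide_inverse power_inverse mult_ac)
    qed
    finally show ?thesis .
  qed
  have single_sum: "(\<Sum>\<xi>\<in>A. Poly_Mapping.single J (g \<xi>)) = Poly_Mapping.single J (\<Sum>\<xi>\<in>A. g \<xi>)"
    for A J and g :: "('m \<Rightarrow> 'n algfun) \<Rightarrow> 'n algfun"
    by (induction A rule: infinite_finite_induct) (simp_all add: single_add)
  have "pushforward \<I> w I = (\<Sum>J\<in>{J. card J = card I}. \<Sum>\<xi>\<in>zero_set \<I>. Poly_Mapping.single J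
      (rateval (\<lambda>c. to_ac (ratfun_const c)) \<xi> w * minor (jacobian_point \<xi>) I J))"
    unfolding pushforward_def pullback_def by (rule sum.swap)
  also have "\<dots> = (\<Sum>J\<in>{J. card J = p}. Poly_Mapping.single J
      (to_ac (mat_trace (rat_at_mats (zero_set \<I>) (length es) T (omega_minor f w I J)))))"
    unfolding I by (rule sum.cong) (simp_all add: single_sum coeff)
  finally show ?thesis .
qed

end
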